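(* If $A\subset \mathbb{R}^2$ is a nonempty closed and connected set having property $(K^s)$, then $A$ is a line segment, a circular arc or a singleton.
   Context: Identify the plane $\mathbb{R}^2$ with $\mathbb{C}$. A rigid motion is an orientation-preserving isometry of the plane (a translation or a rotation), i.e. a map $x\mapsto ux+c$ with $u,c\in\mathbb{C}$, $|u|=1$. The identity map is denoted by $j$. A continuous movement $M$ is a map $t\mapsto M_t$ ($t\in[0,1]$) such that $M_t$ is a rigid motion for every $t\in[0,1]$, the map $(t,x)\mapsto M_t(x)$ is continuous on $[0,1]\times\mathbb{R}^2$, and $M_0=j$. For a set $A\subset\mathbb{R}^2$ put $W_M(A)=\{M_t(x)\colon t\in[0,1],\ x\in A\}$. Let $\lambda$ denote two-dimensional Lebesgue measure. The set $A$ has property $(K^s)$ (the strong Kakeya property) if for every rigid motion $\alpha$ and for every $\varepsilon>0$ there exists a continuous movement $M$ with $M_1=\alpha$ and $\lambda(W_M(A))<\varepsilon$. Here a circular arc means a proper subarc of a circle; a full circle is not counted as a circular arc. *)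

theory Defs
  imports "HOL-Analysis.Analysis"
begin

definition rigid_motion :: "(complex \<Rightarrow> complex) \<Rightarrow> bool" where
  "rigid_motion f \<longleftrightarrow> (\<exists>u c. norm u = 1 \<and> f = (\<lambda>x. u * x + c))"

text \<open>Movements are total in the time parameter; only the times in \<open>{0..1}\<close> matter.\<close>

definition continuous_movement :: "(real \<Rightarrow> complex \<Rightarrow> complex) \<Rightarrow> bool" where
  "continuous_movement M \<longleftrightarrow>
     (\<forall>t\<in>{0..1}. rigid_motion (M t)) \<and>
     continuous_on ({0..1} \<times> UNIV) (\<lambda>(t, x). M t x) \<and>
     M 0 = id"

definition swept_set :: "(real \<Rightarrow> complex \<Rightarrow> complex) \<Rightarrow> complex set \<Rightarrow> complex set" where
  "swept_set M A = {M t x | t x. t \<in> {0..1} \<and> x \<in> A}"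

lemma swept_set_measurable:
  assumes "continuous_movement M" and "closed A"
  shows "swept_set M A \<in> sets lebesgue"
proof -
  have eq: "swept_set M A = (\<Union>n::nat. (\<lambda>(t, x). M t x) ` ({0..1} \<times> (A \<inter> cball 0 (real n))))"
  proof (intro equalityI subsetI)
    fix y assume "y \<in> swept_set M A"
    then obtain t x where tx: "y = M t x" "t \<in> {0..1}" "x \<in> A"
      by (auto simp: swept_set_def)
    obtain n :: nat where "norm x \<le> real n"
      using real_arch_simple by blast
    with tx show "y \<in> (\<Union>n::nat. (\<lambda>(t, x). M t x) ` ({0..1} \<times> (A \<inter> cball 0 (real n))))"
      by force
  qed (fastforce simp: swept_set_def)
  have "compact ((\<lambda>(t, x). M t x) ` ({0..1} \<times> (A \<inter> cball 0 (real n))))" for n :: nat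
  proof (rule compact_continuous_image)
    show "continuous_on ({0..1} \<times> (A \<inter> cball 0 (real n))) (\<lambda>(t, x). M t x)"
      using assms(1) unfolding continuous_movement_def
      by (elim conjE) (rule continuous_on_subset, auto)
    show "compact ({0..1::real} \<times> (A \<inter> cball 0 (real n)))"
      using assms(2) by (intro compact_Times closed_Int_compact) auto
  qed
  then have "(\<lambda>(t, x). M t x) ` ({0..1} \<times> (A \<inter> cball 0 (real n))) \<in> sets lebesgue" for n :: nat
    using borel_compact by force
  then show ?thesis
    unfolding eq by (intro sets.countable_UN) auto
qed

text \<open>
  The measurability clause keeps the definition meaningful for arbitrary \<open>A\<close>, since \<open>emeasure\<close>
  is \<open>0\<close> on non-measurable sets. For closed \<open>A\<close> it is automatic by \<open>swept_set_measurable\<close>.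
\<close>

definition strong_kakeya :: "complex set \<Rightarrow> bool" where
  "strong_kakeya A \<longleftrightarrow>
     (\<forall>\<alpha> \<epsilon>. rigid_motion \<alpha> \<and> \<epsilon> > 0 \<longrightarrow>
        (\<exists>M. continuous_movement M \<and> M 1 = \<alpha> \<and>
             swept_set M A \<in> sets lebesgue \<and>
             emeasure lebesgue (swept_set M A) < ennreal \<epsilon>))"

text \<open>
  Segments and arcs contain their endpoints and are nondegenerate. The bound
  \<open>b < a + 2 * pi\<close> excludes the full circle.
\<close>

definition is_line_segment :: "complex set \<Rightarrow> bool" where
  "is_line_segment A \<longleftrightarrow> (\<exists>a b. a \<noteq> b \<and> A = closed_segment a b)"

definition is_circular_arc :: "complex set \<Rightarrow> bool" where
  "is_circular_arc A \<longleftrightarrow>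
     (\<exists>c r a b. r > 0 \<and> a < b \<and> b < a + 2 * pi \<and>
        A = (\<lambda>\<theta>. c + of_real r * cis \<theta>) ` {a..b})"

end

(*
  Follow points by the inverse motions x \<mapsto> v t * x + d t. A point outside the swept set is carried
  along a curve that misses A. Stop a movement when it first leaves a small neighbourhood of the
  identity and iterate the rigid motion B reached at that time: since the swept area is tiny, some
  point of any given ball has its whole relevant B-orbit outside the swept set, and the short curves
  joining consecutive orbit points fit together to a long curve that misses A and runs close to an
  orbit of a one-parameter group. A subsequence of these groups converges. If the limit consists of
  rotations about z and |x - z| is not constant on A, the curve closes up to a loop around z missing
  A that separates points of A by its winding number. If the limit consists of translations, the
  same happens after applying a suitable exponential map. So A lies on a circle or a line. Moving A
  by the point reflection in 0 shows that A is bounded, and moving a full circle far away sweeps its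
  disc.
*)
theory Submission
  imports Defs "HOL-Complex_Analysis.Complex_Analysis"
begin

section \<open>Lebesgue measure of the plane under rigid motions\<close>

text \<open>\<open>measure_orthogonal_image\<close> concerns \<open>real^'n\<close>; rotation
  invariance is carried over to the complex plane through this identification.\<close>

definition vec2_complex :: "real^2 \<Rightarrow> complex" where
  "vec2_complex w = Complex (vec_nth w 1) (vec_nth w 2)"

lemma vec2_complex_measurable [measurable]: "vec2_complex \<in> borel_measurable borel"
  unfolding vec2_complex_def [abs_def] Complex_eq
  by (intro borel_measurable_continuous_onI continuous_intros)

lemma distr_vec2_complex: "distr lborel borel vec2_complex = lborel"
proof (rule lborel_eqI[symmetric])
  fix l u :: complex
  assume le: "\<And>b. b \<in> Basis \<Longrightarrow> l \<bullet> b \<le> u \<bullet> b"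
  have vim: "vec2_complex -` box l u = box (vector [Re l, Im l]) (vector [Re u, Im u])"
    by (auto simp: mem_box_cart in_box_complex_iff forall_2 vec2_complex_def)
  have le': "Re l \<le> Re u" "Im l \<le> Im u"
    using le[of 1] le[of \<i>] by (auto simp: Basis_complex_def)
  have ne: "axis (1::2) (1::real) \<noteq> axis 2 1"
    by (simp add: axis_eq_axis)
  have B: "(Basis :: (real^2) set) = {axis 1 1, axis 2 1}"
    by (auto simp: Basis_vec_def UNIV_2)
  have "emeasure (distr lborel borel vec2_complex) (box l u)
      = emeasure lborel (box (vector [Re l, Im l] :: real^2) (vector [Re u, Im u]))"
    by (simp add: emeasure_distr vim)
  also have "\<dots> = ennreal (\<Prod>b\<in>Basis. (vector [Re u, Im u] - vector [Re l, Im l] :: real^2) \<bullet> b)"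
    by (rule emeasure_lborel_box) (auto simp: B inner_axis le')
  also have "(\<Prod>b\<in>Basis. (vector [Re u, Im u] - vector [Re l, Im l] :: real^2) \<bullet> b)
      = (Re u - Re l) * (Im u - Im l)"
    using ne by (simp add: B inner_axis)
  also have "(Re u - Re l) * (Im u - Im l) = (\<Prod>b\<in>Basis. (u - l) \<bullet> b)"
    by (simp add: Basis_complex_def)
  finally show "emeasure (distr lborel borel vec2_complex) (box l u)
      = ennreal (\<Prod>b\<in>Basis. (u - l) \<bullet> b)" .
qed simp

text \<open>Read in \<open>real^2\<close>, preimages under multiplication by \<open>u\<close> are
  images under the orthogonal map \<open>f\<close> built from \<open>cnj u\<close>, and orthogonal
  images preserve measure. Comparing the two measures on boxes suffices.\<close>

lemma distr_rotation_complex: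
  fixes u :: complex
  assumes u: "norm u = 1"
  shows "distr lborel borel ((*) u) = lborel"
proof (rule lborel_eqI[symmetric])
  fix a b :: complex
  assume le: "\<And>i. i \<in> Basis \<Longrightarrow> a \<bullet> i \<le> b \<bullet> i"
  have meas: "(*) u \<in> borel_measurable borel"
    by (intro borel_measurable_continuous_onI continuous_intros)
  define h :: "complex \<Rightarrow> real^2" where "h = (\<lambda>z. vector [Re z, Im z])"
  define f where "f = h \<circ> (*) (cnj u) \<circ> vec2_complex"
  have hv: "h (vec2_complex w) = w" for w
    by (simp add: h_def vec2_complex_def vec_eq_iff forall_2)
  have vh: "vec2_complex (h z) = z" for z
    by (simp add: h_def vec2_complex_def)
  have uu: "u * cnj u = 1"
    using u complex_norm_square[of u] by simp
  have "linear f"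
    by (rule linearI) (simp_all add: f_def h_def vec2_complex_def vec_eq_iff forall_2 algebra_simps)
  moreover have "norm (f w) = norm w" for w
  proof -
    have "norm (h z) = norm z" for z
      by (simp add: h_def norm_vec_def L2_set_def UNIV_2 cmod_def)
    then show ?thesis
      using u by (metis comp_apply f_def hv norm_mult complex_mod_cnj mult_1)
  qed
  ultimately have orth: "orthogonal_transformation f"
    by (simp add: orthogonal_transformation)
  have fim: "vec2_complex -` ((*) u -` S) = f ` (vec2_complex -` S)" for S
  proof (intro set_eqI iffI)
    fix w assume "w \<in> vec2_complex -` ((*) u -` S)"
    moreover have "w = f (h (u * vec2_complex w))"
      using uu by (simp add: f_def vh hv flip: mult.assoc) (simp add: mult.commute hv)
    ultimately show "w \<in> f ` (vec2_complex -` S)"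
      by (metis imageI vimageE vimageI vh)
  qed (use uu in \<open>auto simp: f_def vh simp flip: mult.assoc\<close>)
  have leb: "(*) u -` box a b \<in> sets borel"
    using measurable_sets_borel[OF meas] by auto
  have em: "emeasure lborel S = emeasure lborel (vec2_complex -` S)" if "S \<in> sets borel" for S
    using that by (subst distr_vec2_complex[symmetric]) (simp add: emeasure_distr)
  have lm: "vec2_complex -` box a b \<in> lmeasurable"
  proof (rule fmeasurableI)
    show "vec2_complex -` box a b \<in> sets lebesgue"
      using measurable_sets_borel[OF vec2_complex_measurable, of "box a b"] by auto
    have "emeasure lborel (vec2_complex -` box a b) < \<infinity>"
      using emeasure_lborel_box_finite[of a b] em[of "box a b"] by simp
    then show "emeasure lebesgue (vec2_complex -` box a b) < \<infinity>"
      using measurable_sets_borel[OF vec2_complex_measurable, of "box a b"] by simp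
  qed
  have "emeasure (distr lborel borel ((*) u)) (box a b) = emeasure lborel ((*) u -` box a b)"
    using meas by (simp add: emeasure_distr)
  also have "\<dots> = emeasure lborel (f ` (vec2_complex -` box a b))"
    using em[OF leb] by (simp add: fim)
  also have "\<dots> = emeasure lebesgue (f ` (vec2_complex -` box a b))"
  proof -
    have "f ` (vec2_complex -` box a b) \<in> sets borel"
      unfolding fim[symmetric]
      using measurable_sets_borel[OF vec2_complex_measurable leb] by simp
    then show ?thesis by simp
  qed
  also have "\<dots> = emeasure lebesgue (vec2_complex -` box a b)"
    using measurable_orthogonal_image[OF orth lm] measure_orthogonal_image[OF orth lm] lm
    by (simp add: emeasure_eq_measure2)
  also have "\<dots> = emeasure lborel (box a b)"
    using em[of "box a b"] measurable_sets_borel[OF vec2_complex_measurable, of "box a b"] by simp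
  also have "\<dots> = ennreal (\<Prod>i\<in>Basis. (b - a) \<bullet> i)"
    using le by simp
  finally show "emeasure (distr lborel borel ((*) u)) (box a b) = ennreal (\<Prod>i\<in>Basis. (b - a) \<bullet> i)" .
qed simp

lemma emeasure_vimage_rigid:
  fixes u c :: complex
  assumes u: "norm u = 1" and S: "S \<in> sets borel"
  shows "emeasure lborel ((\<lambda>x. u * x + c) -` S) = emeasure lborel S"
proof -
  have meas: "(*) u \<in> borel_measurable borel" "(+) c \<in> borel_measurable borel"
    by (intro borel_measurable_continuous_onI continuous_intros)+
  have "emeasure lborel S = emeasure (distr lborel borel ((+) c)) S"
    by (simp add: lborel_distr_plus)
  also have "\<dots> = emeasure lborel ((+) c -` S)"
    using meas S by (simp add: emeasure_distr)
  also have "\<dots> = emeasure (distr lborel borel ((*) u)) ((+) c -` S)"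
    by (simp add: distr_rotation_complex u)
  also have "\<dots> = emeasure lborel ((*) u -` ((+) c -` S))"
    using meas measurable_sets_borel[OF meas(2) S] by (simp add: emeasure_distr)
  also have "(*) u -` ((+) c -` S) = (\<lambda>x. u * x + c) -` S"
    by (auto simp: add.commute)
  finally show ?thesis by simp
qed

section \<open>Orbits of a rigid motion that avoid a set of small measure\<close>

lemma emeasure_ball_pos:
  fixes x :: "'a :: euclidean_space"
  assumes "0 < r"
  shows "0 < emeasure lborel (ball x r)"
  using assms open_not_negligible[of "ball x r"]
  by (auto simp: negligible_iff_null_sets null_sets_def zero_less_iff_neq_zero)

lemma rigid_funpow:
  fixes u c :: complex
  assumes "norm u = 1"
  obtains v d where "norm v = 1" "((\<lambda>x. u * x + c) ^^ k) = (\<lambda>x. v * x + d)"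
proof -
  have "\<exists>v d. norm v = 1 \<and> ((\<lambda>x. u * x + c) ^^ k) = (\<lambda>x. v * x + d)"
  proof (induction k)
    case 0
    show ?case by (rule exI[of _ 1], rule exI[of _ 0]) (auto simp: fun_eq_iff)
  next
    case (Suc k)
    then obtain v d where vd: "norm v = 1" "((\<lambda>x. u * x + c) ^^ k) = (\<lambda>x. v * x + d)" by blast
    show ?case
      by (rule exI[of _ "u * v"], rule exI[of _ "u * d + c"])
        (use vd assms in \<open>simp add: norm_mult fun_eq_iff algebra_simps\<close>)
  qed
  with that show thesis by blast
qed

text \<open>A union bound: the points whose \<open>k\<close>-th iterate falls into \<open>U\<close>
  form a preimage of \<open>U\<close> under a rigid motion, so they have the measure of
  \<open>U\<close>, and \<open>N\<close> such sets are too small to cover the ball.\<close>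

lemma orbit_avoiding_open_set:
  fixes u c :: complex
  assumes u: "norm u = 1" and U: "open U" "emeasure lborel U < ennreal \<epsilon>"
    and N: "ennreal (real N * \<epsilon>) \<le> emeasure lborel (ball p r)" and \<epsilon>: "0 < \<epsilon>" "0 < r"
  obtains x where "x \<in> ball p r" "\<And>k. k < N \<Longrightarrow> ((\<lambda>x. u * x + c) ^^ k) x \<notin> U"
proof -
  let ?B = "\<lambda>x. u * x + c"
  have *: "(?B ^^ k) -` U \<in> sets borel \<and> emeasure lborel ((?B ^^ k) -` U) = emeasure lborel U" for k
  proof -
    obtain v d where vd: "norm v = 1" "(?B ^^ k) = (\<lambda>x. v * x + d)"
      using rigid_funpow[OF u] by blast
    have "(\<lambda>x. v * x + d) \<in> borel_measurable borel"
      by (intro borel_measurable_continuous_onI continuous_intros)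
    from measurable_sets_borel[OF this] have "(\<lambda>x. v * x + d) -` U \<in> sets borel"
      using U by auto
    then show ?thesis
      using emeasure_vimage_rigid[OF vd(1), of U d] U by (simp add: vd)
  qed
  have "\<not> ball p r \<subseteq> (\<Union>k<N. (?B ^^ k) -` U)"
  proof
    assume sub: "ball p r \<subseteq> (\<Union>k<N. (?B ^^ k) -` U)"
    have pos: "0 < emeasure lborel (ball p r)"
      using \<epsilon>(2) by (rule emeasure_ball_pos)
    have "emeasure lborel (ball p r) \<le> emeasure lborel (\<Union>k<N. (?B ^^ k) -` U)"
      using sub * by (intro emeasure_mono) auto
    also have "\<dots> \<le> (\<Sum>k<N. emeasure lborel ((?B ^^ k) -` U))"
      using * by (intro emeasure_subadditive_finite) auto
    also have "\<dots> = of_nat N * emeasure lborel U"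
      using * by simp
    finally have le: "emeasure lborel (ball p r) \<le> of_nat N * emeasure lborel U" .
    then have "N \<noteq> 0" using pos by (intro notI) simp
    then have "of_nat N * emeasure lborel U < of_nat N * ennreal \<epsilon>"
      using U by (intro ennreal_mult_strict_left_mono) (auto simp: ennreal_of_nat_eq_real_of_nat)
    also have "\<dots> = ennreal (real N * \<epsilon>)"
      using \<epsilon> by (simp add: ennreal_mult ennreal_of_nat_eq_real_of_nat)
    finally show False using le N by (metis leD order_le_less_trans)
  qed
  then show thesis using that by blast
qed

section \<open>Separation by curves in logarithmic coordinates\<close>

text \<open>The exponential of \<open>\<Phi>\<close> is a loop in an annulus with winding number
  \<open>m\<close> about 0. The winding number is constant on the disc of radius
  \<open>norm k1\<close> and on \<open>K\<close>, both missed by the loop, and is zero at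
  \<open>k2\<close> beyond the annulus. This forces \<open>m = 0\<close>.\<close>

lemma exp_path_separates:
  fixes \<Phi> :: "real \<Rightarrow> complex" and K :: "complex set"
  assumes "path \<Phi>" and m: "m \<noteq> 0"
    and per: "pathfinish \<Phi> = pathstart \<Phi> + 2 * of_real pi * \<i> * of_int m"
    and K: "connected K" "\<And>\<zeta>. \<zeta> \<in> path_image \<Phi> \<Longrightarrow> exp \<zeta> \<notin> K"
    and bd: "\<And>\<zeta>. \<zeta> \<in> path_image \<Phi> \<Longrightarrow> s1 < norm (exp \<zeta>) \<and> norm (exp \<zeta>) < s2"
    and k: "k1 \<in> K" "norm k1 \<le> s1" "k2 \<in> K" "s2 \<le> norm k2"
  shows False
proof -
  define \<gamma> where "\<gamma> = exp \<circ> \<Phi>"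
  have \<gamma>: "path \<gamma>"
    unfolding \<gamma>_def using \<open>path \<Phi>\<close> by (intro path_continuous_image continuous_intros)
  have img: "path_image \<gamma> = exp ` path_image \<Phi>"
    by (simp add: \<gamma>_def path_image_compose)
  have loop: "pathfinish \<gamma> = pathstart \<gamma>"
    using exp_integer_2pi[of "of_int m"]
    by (simp add: \<gamma>_def pathfinish_compose pathstart_compose per exp_add mult_ac)
  have "s1 < s2"
    using bd[OF pathstart_in_path_image] by linarith
  have w0: "winding_number \<gamma> 0 = of_int m"
    unfolding \<gamma>_def winding_number_compose_exp[OF \<open>path \<Phi>\<close>] per by simp
  have "winding_number \<gamma> 0 = winding_number \<gamma> k1"
    by (rule winding_number_eq[OF \<gamma> loop, where S = "cball 0 (norm k1)"])
      (use bd k in \<open>auto simp: img\<close>, force+)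
  also have "winding_number \<gamma> k1 = winding_number \<gamma> k2"
    by (rule winding_number_eq[OF \<gamma> loop, where S = K]) (use K k in \<open>auto simp: img\<close>)
  also have "winding_number \<gamma> k2 = 0"
    by (rule winding_number_zero_outside[OF \<gamma> convex_ball loop, of _ 0 s2]) (use bd k in \<open>auto simp: img\<close>)
  finally show False using w0 m by simp
qed

text \<open>With \<open>path_component\<close> the loop can be assembled from short pieces by
  transitivity, without parametrising the whole.\<close>

corollary exp_path_component_separates:
  fixes K :: "complex set"
  assumes "path_component {\<zeta>. exp \<zeta> \<notin> K \<and> s1 < norm (exp \<zeta>) \<and> norm (exp \<zeta>) < s2}
      c (c + 2 * of_real pi * \<i> * of_int m)"
    and "m \<noteq> 0" "connected K" "k1 \<in> K" "norm k1 \<le> s1" "k2 \<in> K" "s2 \<le> norm k2"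
  shows False
proof -
  obtain \<Phi> where \<Phi>: "path \<Phi>"
      "path_image \<Phi> \<subseteq> {\<zeta>. exp \<zeta> \<notin> K \<and> s1 < norm (exp \<zeta>) \<and> norm (exp \<zeta>) < s2}"
      "pathstart \<Phi> = c" "pathfinish \<Phi> = c + 2 * of_real pi * \<i> * of_int m"
    using assms(1) unfolding path_component_def by blast
  show False
    by (rule exp_path_separates[of \<Phi> m K s1 s2 k1 k2]) (use \<Phi> assms in auto)
qed

lemma path_on_unit_interval:
  assumes "continuous_on {0..1::real} f" "\<And>t. t \<in> {0..1} \<Longrightarrow> f t \<in> S" "f 0 = a" "f 1 = b"
  shows "path_component S a b"
  unfolding path_component_def
  using assms by (intro exI[of _ f]) (auto simp: path_def path_image_def pathstart_def pathfinish_def)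

text \<open>The curve is lifted through \<open>exp\<close>. Since the perturbation \<open>d\<close>
  is smaller than the main term, the quotient \<open>q\<close> stays in the right half-plane, where
  \<open>Ln\<close> is continuous; since \<open>d\<close> vanishes at both ends, so does the
  correction \<open>Ln (q t)\<close>.\<close>

lemma path_component_log_motion:
  fixes \<psi> d :: "real \<Rightarrow> complex"
  assumes cont: "continuous_on {0..1} \<psi>" "continuous_on {0..1} d"
    and ends: "\<psi> 0 = 0" "d 0 = 0" "d 1 = 0"
    and small: "\<And>t. t \<in> {0..1} \<Longrightarrow> norm (d t) < norm (exp (\<psi> t) * exp c)"
    and G: "\<And>t \<zeta>. t \<in> {0..1} \<Longrightarrow> exp \<zeta> = exp (\<psi> t) * exp c + d t \<Longrightarrow> \<zeta> \<in> G"
  shows "path_component G c (c + \<psi> 1)"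
proof -
  define q where "q t = 1 + d t / (exp (\<psi> t) * exp c)" for t
  have q: "0 < Re (q t)" if "t \<in> {0..1}" for t
  proof -
    have "norm (d t / (exp (\<psi> t) * exp c)) < 1"
      using small[OF that] by (simp add: norm_divide)
    then show ?thesis
      using abs_Re_le_cmod[of "d t / (exp (\<psi> t) * exp c)"] by (simp add: q_def)
  qed
  have q': "q t \<notin> \<real>\<^sub>\<le>\<^sub>0" "q t \<noteq> 0" if "t \<in> {0..1}" for t
    using q[OF that] by (auto simp: complex_nonpos_Reals_iff)
  show ?thesis
  proof (rule path_on_unit_interval[of "\<lambda>t. c + \<psi> t + Ln (q t)"])
    have "continuous_on {0..1} q"
      unfolding q_def [abs_def] by (intro continuous_intros cont) auto
    then show "continuous_on {0..1} (\<lambda>t. c + \<psi> t + Ln (q t))"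
      using q' by (intro continuous_intros cont) auto
    show "c + \<psi> t + Ln (q t) \<in> G" if t: "t \<in> {0..1}" for t
    proof (rule G[OF t])
      have "exp (c + \<psi> t + Ln (q t)) = exp c * exp (\<psi> t) * q t"
        using q'(2)[OF t] by (simp add: exp_add)
      also have "\<dots> = exp (\<psi> t) * exp c + d t"
        by (simp add: q_def ring_distribs)
      finally show "exp (c + \<psi> t + Ln (q t)) = exp (\<psi> t) * exp c + d t" .
    qed
  qed (use ends in \<open>auto simp: q_def\<close>)
qed

section \<open>First consequences of the strong Kakeya property\<close>

text \<open>If an inverse motion carried \<open>x\<close> into \<open>A\<close> at time
  \<open>t\<close>, then \<open>M t\<close> would carry a point of \<open>A\<close> to
  \<open>x\<close>, so \<open>x\<close> would be swept. The movement is chosen to end at the inverse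
  of \<open>x \<mapsto> w * x + e\<close>. The swept set is enlarged to an open \<open>U\<close> so
  that its preimages are Borel.\<close>

lemma strong_kakeya_inverse_motions:
  assumes sk: "strong_kakeya A" and w: "norm w = 1" and \<epsilon>: "0 < \<epsilon>"
  obtains v d U where
    "continuous_on {0..1::real} v" "continuous_on {0..1} d" "\<And>t. t \<in> {0..1} \<Longrightarrow> norm (v t) = 1"
    "v 0 = 1" "d 0 = 0" "v 1 = w" "d 1 = e" "open U" "emeasure lborel U < ennreal \<epsilon>"
    "\<And>x t. x \<notin> U \<Longrightarrow> t \<in> {0..1} \<Longrightarrow> v t * x + d t \<notin> A"
proof -
  have "rigid_motion (\<lambda>x. cnj w * x + (- cnj w * e))"
    using w unfolding rigid_motion_def by (intro exI[of _ "cnj w"] exI[of _ "- cnj w * e"]) auto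
  with sk \<epsilon> obtain M where M: "continuous_movement M" "M 1 = (\<lambda>x. cnj w * x + (- cnj w * e))"
      and W: "swept_set M A \<in> sets lebesgue" "emeasure lebesgue (swept_set M A) < ennreal \<epsilon>"
    unfolding strong_kakeya_def by blast
  \<comment> \<open>Coefficients read off from the values at 0 and 1 are continuous in
    \<open>t\<close>.\<close>
  define u where "u t = M t 1 - M t 0" for t
  define c where "c t = M t 0" for t
  have rm: "norm (u t) = 1 \<and> M t = (\<lambda>x. u t * x + c t)" if "t \<in> {0..1}" for t
  proof -
    have "rigid_motion (M t)"
      using M(1) that by (simp add: continuous_movement_def)
    then obtain u' c' where "norm u' = 1" "M t = (\<lambda>x. u' * x + c')"
      unfolding rigid_motion_def by blast
    then show ?thesis by (auto simp: u_def c_def)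
  qed
  have contM: "continuous_on {0..1} (\<lambda>t. M t x)" for x
  proof -
    have "continuous_on ({0..1} \<times> UNIV) (\<lambda>(t, x). M t x)"
      using M by (simp add: continuous_movement_def)
    then have "continuous_on {0..1} ((\<lambda>(t, x). M t x) \<circ> (\<lambda>t. (t, x)))"
      by (intro continuous_on_compose continuous_intros) (auto elim: continuous_on_subset)
    then show ?thesis by (simp add: o_def)
  qed
  have M0: "u 0 = 1" "c 0 = 0"
    using M by (auto simp: continuous_movement_def u_def c_def)
  \<comment> \<open>\<open>n\<close> is room left below \<open>\<epsilon>\<close>, to be spent on
    the open superset.\<close>
  obtain n where "0 < n" "emeasure lebesgue (swept_set M A) + ennreal n < ennreal \<epsilon>"
  proof -
    obtain m where m: "emeasure lebesgue (swept_set M A) = ennreal m" "0 \<le> m"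
      using W(2) by (metis ennreal_cases ennreal_less_top not_less_iff_gr_or_eq order_less_trans)
    then have "m < \<epsilon>" using W(2) by (simp add: ennreal_less_iff)
    with m that[of "(\<epsilon> - m) / 2"] show thesis
      by (auto simp: ennreal_less_iff field_simps simp flip: ennreal_plus)
  qed
  obtain U where U: "open U" "swept_set M A \<subseteq> U" "U - swept_set M A \<in> lmeasurable"
      "emeasure lebesgue (U - swept_set M A) < ennreal n"
    using sets_lebesgue_outer_open[OF W(1) \<open>0 < n\<close>] .
  have "emeasure lborel U = emeasure lebesgue U"
    using U(1) by simp
  also have "\<dots> = emeasure lebesgue (swept_set M A \<union> (U - swept_set M A))"
    using U(2) by (simp add: Un_absorb1)
  also have "\<dots> \<le> emeasure lebesgue (swept_set M A) + emeasure lebesgue (U - swept_set M A)"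
    using U(3) W(1) by (intro emeasure_subadditive) auto
  also have "\<dots> \<le> emeasure lebesgue (swept_set M A) + ennreal n"
    using U(4) by (intro add_left_mono) auto
  also have "\<dots> < ennreal \<epsilon>" by fact
  finally have eU: "emeasure lborel U < ennreal \<epsilon>" .
  have cu: "continuous_on {0..1} u" and cc: "continuous_on {0..1} c"
    unfolding u_def [abs_def] c_def [abs_def] by (intro continuous_intros contM)+
  have inv: "u t * (cnj (u t) * x + - cnj (u t) * c t) + c t = x" if "t \<in> {0..1}" for x t
  proof -
    have "u t * cnj (u t) = 1"
      using rm[OF that] complex_norm_square[of "u t"] by simp
    moreover have "u t * (cnj (u t) * x + - cnj (u t) * c t) + c t
        = (u t * cnj (u t)) * x - (u t * cnj (u t)) * c t + c t"
      by (simp add: algebra_simps)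
    ultimately show ?thesis by simp
  qed
  show thesis
  proof (rule that[of "\<lambda>t. cnj (u t)" "\<lambda>t. - cnj (u t) * c t" U])
    show "continuous_on {0..1} (\<lambda>t. cnj (u t))" "continuous_on {0..1} (\<lambda>t. - cnj (u t) * c t)"
      by (intro continuous_intros cu cc)+
    show "norm (cnj (u t)) = 1" if "t \<in> {0..1}" for t
      using rm[OF that] by simp
    show "cnj (u 1) = w"
      by (simp add: u_def M(2))
    have "w * cnj w = 1"
      using w complex_norm_square[of w] by simp
    then show "- cnj (u 1) * c 1 = e"
      by (simp add: u_def M(2) c_def flip: mult.assoc)
    show "cnj (u t) * x + - cnj (u t) * c t \<notin> A" if "x \<notin> U" "t \<in> {0..1}" for x t
    proof
      assume a: "cnj (u t) * x + - cnj (u t) * c t \<in> A"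
      have eq: "M t (cnj (u t) * x + - cnj (u t) * c t) = x"
        using rm[OF that(2)] inv[OF that(2)] by simp
      then have "x \<in> swept_set M A"
        unfolding swept_set_def
        by (intro CollectI exI conjI) (rule eq[symmetric], rule that(2), rule a)
      with U(2) that(1) show False by blast
    qed
  qed (use M0 U eU in auto)
qed

lemma ennreal_pos_obtain_real:
  assumes "(0::ennreal) < m"
  obtains \<epsilon> where "0 < \<epsilon>" "ennreal \<epsilon> \<le> m"
proof (cases m)
  case (real r)
  with assms that[of r] show thesis by auto
next
  case top
  with that[of 1] show thesis by simp
qed

text \<open>The movement starts at the identity, so \<open>A\<close> itself is swept; a ball inside
  \<open>A\<close> would bound the swept area from below.\<close>

lemma strong_kakeya_interior_empty:
  assumes sk: "strong_kakeya A"
  shows "interior A = {}"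
proof (rule ccontr)
  assume "interior A \<noteq> {}"
  then obtain x r where r: "0 < r" "ball x r \<subseteq> A"
    by (metis all_not_in_conv mem_interior)
  obtain \<epsilon> where \<epsilon>: "0 < \<epsilon>" "ennreal \<epsilon> \<le> emeasure lborel (ball x r)"
    using ennreal_pos_obtain_real[OF emeasure_ball_pos[OF r(1), of x]] .
  obtain v d :: "real \<Rightarrow> complex" and U where U: "v 0 = 1" "d 0 = 0" "open U" "emeasure lborel U < ennreal \<epsilon>"
      "\<And>x t. x \<notin> U \<Longrightarrow> t \<in> {0..1} \<Longrightarrow> v t * x + d t \<notin> A"
    using strong_kakeya_inverse_motions[OF sk, of 1 \<epsilon> 0] \<epsilon> by (metis norm_one)
  have "ball x r \<subseteq> U"
    using U(5)[where t = 0] U(1,2) r(2) by auto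
  then have "emeasure lborel (ball x r) \<le> emeasure lborel U"
    using U(3) by (intro emeasure_mono) auto
  with U(4) \<epsilon>(2) show False
    by (metis leD order_le_less_trans)
qed

text \<open>
  For large \<open>p\<close>, moving \<open>p\<close> to \<open>- p\<close> and then \<open>- p\<close> to \<open>p\<close> gives a loop of odd winding number, which
  an unbounded connected \<open>A\<close> must meet. Hence \<open>p\<close> or \<open>- p\<close> is swept, and the swept area is infinite.
\<close>

lemma strong_kakeya_connected_imp_bounded:
  assumes sk: "strong_kakeya A" and A: "connected A"
  shows "bounded A"
proof (rule ccontr)
  assume unb: "\<not> bounded A"
  then obtain a where a: "a \<in> A" by fastforce
  obtain v d :: "real \<Rightarrow> complex" and U where
    cont: "continuous_on {0..1} v" "continuous_on {0..1} d" and nv: "\<And>t. t \<in> {0..1} \<Longrightarrow> norm (v t) = 1"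
    and ends: "v 0 = 1" "d 0 = 0" "v 1 = - 1" "d 1 = 0" and U: "open U" "emeasure lborel U < ennreal 1"
    and avoid: "\<And>x t. x \<notin> U \<Longrightarrow> t \<in> {0..1} \<Longrightarrow> v t * x + d t \<notin> A"
    using strong_kakeya_inverse_motions[OF sk, of "- 1" 1 0] by auto
  have "compact (d ` {0..1})"
    by (intro compact_continuous_image cont) auto
  then obtain C where C: "0 < C" "\<And>t. t \<in> {0..1} \<Longrightarrow> norm (d t) < C"
    using compact_imp_bounded bounded_pos_less by (metis (no_types, lifting) image_eqI)
  obtain \<psi>' where \<psi>': "continuous_on {0..1} \<psi>'" "\<And>t. t \<in> {0..1} \<Longrightarrow> v t = exp (\<psi>' t)"
  proof (rule continuous_logarithm_on_contractible[OF cont(1)])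
    show "contractible {0..1::real}"
      by (intro convex_imp_contractible) auto
    show "v t \<noteq> 0" if "t \<in> {0..1}" for t
      using nv[OF that] by auto
  qed auto
  define \<psi> where "\<psi> t = \<psi>' t - \<psi>' 0" for t
  have \<psi>: "continuous_on {0..1} \<psi>" "\<psi> 0 = 0"
    by (auto simp: \<psi>_def [abs_def] intro!: continuous_intros \<psi>')
  have v: "v t = exp (\<psi> t)" if "t \<in> {0..1}" for t
    using \<psi>'(2)[OF that] \<psi>'(2)[of 0] ends(1) by (simp add: \<psi>_def exp_diff)
  have "exp (\<psi> 1) = exp (\<i> * of_real pi)"
    using v[of 1] ends(3) by (simp add: exp_Euler)
  \<comment> \<open>\<open>\<psi> 1\<close> is an odd multiple of \<open>\<i> * pi\<close>, so
    applying it twice gives a nonzero multiple of the period of \<open>exp\<close>, whatever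
    \<open>n\<close> is.\<close>
  then obtain n where n: "\<psi> 1 = \<i> * of_real pi + of_real (of_int (2 * n) * pi) * \<i>"
    unfolding exp_eq by blast
  have dense: "p \<in> U \<or> - p \<in> U" if p: "C + norm a < norm p" for p
  proof (rule ccontr)
    assume "\<not> (p \<in> U \<or> - p \<in> U)"
    then have pU: "p \<notin> U" "- p \<notin> U" by auto
    have "0 < norm p" using p C(1) norm_ge_zero[of a] by linarith
    then have "p \<noteq> 0" by simp
    define G where "G = {\<zeta>. exp \<zeta> \<notin> A \<and> norm p - C < norm (exp \<zeta>) \<and> norm (exp \<zeta>) < norm p + C}"
    have piece: "path_component G c (c + \<psi> 1)" if c: "exp c \<notin> U" "norm (exp c) = norm p" for c
    proof (rule path_component_log_motion[OF \<psi>(1) cont(2) \<psi>(2) ends(2,4)])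
      fix t :: real assume t: "t \<in> {0..1}"
      have "norm (exp (\<psi> t) * exp c) = norm p"
        using nv[OF t] v[OF t] c by (simp add: norm_mult)
      then show "norm (d t) < norm (exp (\<psi> t) * exp c)"
        using C(2)[OF t] p norm_ge_zero[of a] by linarith
      show "\<zeta> \<in> G" if "exp \<zeta> = exp (\<psi> t) * exp c + d t" for \<zeta>
        using norm_triangle_ineq[of "exp (\<psi> t) * exp c" "d t"]
          norm_diff_ineq[of "exp (\<psi> t) * exp c" "d t"]
          \<open>norm (exp (\<psi> t) * exp c) = norm p\<close> C(2)[OF t] avoid[OF c(1) t] v[OF t]
        by (auto simp: G_def that simp del: norm_exp_eq_Re)
    qed
    have "exp (\<psi> 1) = - 1"
      using v[of 1] ends(3) by simp
    with \<open>p \<noteq> 0\<close> have e: "exp (Ln p) = p" "exp (Ln p + \<psi> 1) = - p"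
      by (simp_all add: exp_add)
    have "path_component G (Ln p) (Ln p + \<psi> 1 + \<psi> 1)"
      using piece[of "Ln p"] piece[of "Ln p + \<psi> 1"] pU e
      by (metis norm_minus_cancel path_component_trans)
    also have "Ln p + \<psi> 1 + \<psi> 1 = Ln p + 2 * of_real pi * \<i> * of_int (2 * n + 1)"
      by (simp add: n algebra_simps)
    finally have pc: "path_component G (Ln p) (Ln p + 2 * of_real pi * \<i> * of_int (2 * n + 1))" .
    obtain b where b: "b \<in> A" "norm p + C \<le> norm b"
      using unb unfolding bounded_iff by (meson linear)
    have "2 * n + 1 \<noteq> 0" by presburger
    then show False
      by (rule exp_path_component_separates[OF pc[unfolded G_def] _ A a _ b]) (use p in linarith)
  qed
  have U': "open (uminus -` U)"
    using U(1) by (intro open_vimage continuous_intros)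
  have eU': "emeasure lborel (uminus -` U) = emeasure lborel U"
    using emeasure_vimage_rigid[of "- 1" U 0] U(1) by (simp add: vimage_def)
  have "UNIV = cball 0 (C + norm a) \<union> (U \<union> uminus -` U)"
    using dense by force
  then have "emeasure lborel (UNIV :: complex set) \<le> emeasure lborel (cball (0::complex) (C + norm a)) + emeasure lborel (U \<union> uminus -` U)"
    using U U' by (metis borel_open emeasure_subadditive open_Un borel_closed closed_cball sets_lborel)
  also have "\<dots> \<le> emeasure lborel (cball (0::complex) (C + norm a)) + (emeasure lborel U + emeasure lborel (uminus -` U))"
    using U U' by (intro add_left_mono emeasure_subadditive) auto
  also have "\<dots> < \<infinity>"
    using U(2) emeasure_bounded_finite[OF bounded_cball, of "0::complex" "C + norm a"]
    by (simp add: eU' ennreal_add_less_top) (meson ennreal_less_top order_less_trans ennreal_one_less_top)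
  finally show False by simp
qed

text \<open>Translation by \<open>3 * r\<close> moves the disc off itself. Under the inverse motions
  the distance of a point of the disc from \<open>z\<close> starts below \<open>r\<close> and ends
  above it, so it equals \<open>r\<close> at some time and the point lies in
  \<open>U\<close>.\<close>

lemma not_strong_kakeya_sphere:
  assumes sk: "strong_kakeya (sphere z r)" and r: "0 < r"
  shows False
proof -
  obtain \<epsilon> where \<epsilon>: "0 < \<epsilon>" "ennreal \<epsilon> \<le> emeasure lborel (ball z r)"
    using ennreal_pos_obtain_real[OF emeasure_ball_pos[OF r, of z]] .
  obtain v d :: "real \<Rightarrow> complex" and U where 
    cont: "continuous_on {0..1} v" "continuous_on {0..1} d"
    and ends: "v 0 = 1" "d 0 = 0" "v 1 = 1" "d 1 = of_real (3 * r)" and U: "open U" "emeasure lborel U < ennreal \<epsilon>"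
    and avoid: "\<And>x t. x \<notin> U \<Longrightarrow> t \<in> {0..1} \<Longrightarrow> v t * x + d t \<notin> sphere z r"
    using strong_kakeya_inverse_motions[OF sk, of 1 \<epsilon> "of_real (3 * r)"] \<epsilon> by (metis norm_one)
  have "ball z r \<subseteq> U"
  proof (rule subsetI, rule ccontr)
    fix p assume p: "p \<in> ball z r" "p \<notin> U"
    have "\<exists>t\<ge>0. t \<le> 1 \<and> norm (v t * p + d t - z) = r"
    proof (rule IVT')
      show "norm (v 0 * p + d 0 - z) \<le> r"
        using p ends by (simp add: dist_norm norm_minus_commute)
      have "norm (of_real (3 * r) :: complex) - norm (z - p) \<le> norm (of_real (3 * r) - (z - p))"
        by (rule norm_triangle_ineq2)
      then show "r \<le> norm (v 1 * p + d 1 - z)"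
        using p r ends by (simp add: dist_norm norm_mult algebra_simps)
      show "continuous_on {0..1} (\<lambda>t. norm (v t * p + d t - z))"
        by (intro continuous_intros cont)
    qed auto
    then obtain t where "t \<in> {0..1}" "norm (v t * p + d t - z) = r" by auto
    with avoid[OF p(2)] show False
      by (auto simp: dist_norm norm_minus_commute)
  qed
  then have "emeasure lborel (ball z r) \<le> emeasure lborel U"
    using U(1) by (intro emeasure_mono) auto
  with U(2) \<epsilon>(2) show False
    by (metis leD order_le_less_trans)
qed

section \<open>Small motions and their orbits\<close>

text \<open>
  \<open>v t * x + d t\<close> is the inverse of the movement at time \<open>t\<close>, rescaled so that time \<open>1\<close> is the first
  exit from the \<open>\<delta>\<close>-neighbourhood of the identity; \<open>U\<close> is an open superset of the swept set.
\<close>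

definition small_motion ::
    "complex set \<Rightarrow> real \<Rightarrow> real \<Rightarrow> (real \<Rightarrow> complex) \<Rightarrow> (real \<Rightarrow> complex) \<Rightarrow> complex set \<Rightarrow> bool" where
  "small_motion A \<delta> \<epsilon> v d U \<longleftrightarrow>
     continuous_on {0..1} v \<and> continuous_on {0..1} d \<and> (\<forall>t\<in>{0..1}. norm (v t) = 1) \<and>
     v 0 = 1 \<and> d 0 = 0 \<and> (\<forall>t\<in>{0..1}. norm (v t - 1) + norm (d t) \<le> \<delta>) \<and>
     norm (v 1 - 1) + norm (d 1) = \<delta> \<and> open U \<and> emeasure lborel U < ennreal \<epsilon> \<and>
     (\<forall>x t. x \<notin> U \<longrightarrow> t \<in> {0..1} \<longrightarrow> v t * x + d t \<notin> A)"

text \<open>Along a movement ending at the point reflection, the displacement \<open>h\<close> runs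
  continuously from 0 to 2 and must take the value \<open>\<delta>\<close>. The motion is cut at the
  first such time \<open>t0\<close> and rescaled.\<close>

lemma strong_kakeya_small_motion:
  assumes sk: "strong_kakeya A" and \<epsilon>: "0 < \<epsilon>" and \<delta>: "0 < \<delta>" "\<delta> \<le> 1"
  obtains v d U where "small_motion A \<delta> \<epsilon> v d U"
proof -
  obtain v d :: "real \<Rightarrow> complex" and U where
    cont: "continuous_on {0..1} v" "continuous_on {0..1} d" and nv: "\<And>t. t \<in> {0..1} \<Longrightarrow> norm (v t) = 1"
    and ends: "v 0 = 1" "d 0 = 0" "v 1 = - 1" "d 1 = 0" and U: "open U" "emeasure lborel U < ennreal \<epsilon>"
    and avoid: "\<And>x t. x \<notin> U \<Longrightarrow> t \<in> {0..1} \<Longrightarrow> v t * x + d t \<notin> A"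
    using strong_kakeya_inverse_motions[OF sk, of "- 1" \<epsilon> 0] \<epsilon> by auto
  define h where "h t = norm (v t - 1) + norm (d t)" for t
  have ch: "continuous_on {0..1} h"
    unfolding h_def [abs_def] by (intro continuous_intros cont)
  have h0: "h 0 = 0" and h1: "h 1 = 2"
    by (simp_all add: h_def ends)
  define S where "S = {t \<in> {0..1}. h t = \<delta>}"
  have "compact S"
    unfolding S_def using continuous_closed_preimage_constant[OF ch, of \<delta>]
    by (metis (no_types, lifting) closed_atLeastAtMost compact_Icc compact_Int_closed inf.absorb_iff2 mem_Collect_eq subsetI)
  moreover have "S \<noteq> {}"
    using IVT'[of h 0 \<delta> 1] ch h0 h1 \<delta> by (auto simp: S_def)
  ultimately obtain t0 where t0: "t0 \<in> S" "\<And>t. t \<in> S \<Longrightarrow> t0 \<le> t"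
    using compact_attains_inf by metis
  have le: "h t \<le> \<delta>" if t: "0 \<le> t" "t \<le> t0" for t
  proof (rule ccontr)
    assume "\<not> h t \<le> \<delta>"
    moreover have "continuous_on {0..t} h"
      using t t0 by (intro continuous_on_subset[OF ch]) (auto simp: S_def)
    ultimately obtain s where s: "0 \<le> s" "s \<le> t" "h s = \<delta>"
      using IVT'[of h 0 \<delta> t] h0 \<delta> t by auto
    then have "s \<in> S" using t t0(1) by (auto simp: S_def)
    from t0(2)[OF this] s t have "s = t" by auto
    with s \<open>\<not> h t \<le> \<delta>\<close> show False by simp
  qed
  have t01: "0 \<le> t0" "t0 \<le> 1" "h t0 = \<delta>"
    using t0(1) by (auto simp: S_def)
  have in01: "t0 * t \<in> {0..1}" "t0 * t \<le> t0" "0 \<le> t0 * t" if "t \<in> {0..1}" for t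
    using that t01 by (auto simp: mult_le_one mult_left_le)
  have cr: "continuous_on {0..1} (\<lambda>t. f (t0 * t))" if "continuous_on {0..1} f" for f :: "real \<Rightarrow> complex"
    using in01 by (intro continuous_on_compose2[OF that] continuous_intros) auto
  show thesis
    by (rule that[of "\<lambda>t. v (t0 * t)" "\<lambda>t. d (t0 * t)" U])
      (use in01 nv ends U avoid t01 le in \<open>auto simp: h_def small_motion_def intro!: cr cont\<close>)
qed

text \<open>The chord of angle \<open>t\<close> has length
  \<open>2 * \<bar>sin (t / 2)\<bar>\<close>. This bounds the last gap of an almost closed rotation
  orbit by the length of one step.\<close>

lemma norm_exp_i_minus_1_mono:
  assumes "\<bar>s\<bar> \<le> \<bar>t\<bar>" "\<bar>t\<bar> \<le> pi"
  shows "norm (exp (\<i> * of_real s) - 1) \<le> norm (exp (\<i> * of_real t) - 1)"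
proof -
  have *: "\<bar>sin (x / 2)\<bar> = sin (\<bar>x\<bar> / 2)" if "\<bar>x\<bar> \<le> pi" for x :: real
    using sin_ge_zero[of "\<bar>x\<bar> / 2"] that by (cases "0 \<le> x") auto
  have "sin (\<bar>s\<bar> / 2) \<le> sin (\<bar>t\<bar> / 2)"
    using assms by (intro sin_monotone_2pi_le) auto
  then show ?thesis
    using assms by (simp add: dist_exp_i_1 *)
qed

text \<open>\<open>A\<close> reaches from radius \<open>r1\<close> to radius \<open>r2\<close> about
  the fixed point \<open>z\<close> of one step, and \<open>ball p \<rho>\<close> is free of
  \<open>A\<close> and lies between these radii with margin \<open>\<eta>\<close>. An orbit starting
  near \<open>p\<close> runs almost once around \<open>z\<close>, and the remaining gap is bridged
  inside the ball. The hypothesis \<open>area\<close> pays for all steps of one turn.\<close>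

lemma rotation_case:
  fixes v d :: "real \<Rightarrow> complex" and A U :: "complex set"
  assumes motion: "small_motion A \<delta> \<epsilon> v d U"
    and \<delta>: "0 < \<delta>" "\<delta> < 1" and \<epsilon>: "0 < \<epsilon>"
    and fixp: "v 1 * z + d 1 = z" and v1: "v 1 \<noteq> 1"
    and A: "connected A" "k1 \<in> A" "k2 \<in> A" "norm (k1 - z) \<le> r1" "r2 \<le> norm (k2 - z)"
    and p: "0 < \<rho>" "ball p \<rho> \<inter> A = {}" "\<And>x. x \<in> ball p \<rho> \<Longrightarrow> r1 + \<eta> \<le> norm (x - z) \<and> norm (x - z) \<le> r2 - \<eta>"
    and \<eta>: "\<delta> * (1 + norm z) < \<eta>" and r2: "r2 * \<delta> < \<rho> / 2"
    and area: "ennreal (2 * pi / norm (v 1 - 1) * \<epsilon>) \<le> emeasure lborel (ball p (\<rho> / 2))"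
  shows False
proof -
  have cont: "continuous_on {0..1} v" "continuous_on {0..1} d" and nv: "\<And>t. t \<in> {0..1} \<Longrightarrow> norm (v t) = 1"
    and ends: "v 0 = 1" "d 0 = 0" and small: "\<And>t. t \<in> {0..1} \<Longrightarrow> norm (v t - 1) + norm (d t) \<le> \<delta>"
    and U: "open U" "emeasure lborel U < ennreal \<epsilon>"
    and avoid: "\<And>x t. x \<notin> U \<Longrightarrow> t \<in> {0..1} \<Longrightarrow> v t * x + d t \<notin> A"
    using motion by (simp_all add: small_motion_def)
  \<comment> \<open>As \<open>\<delta> < 1\<close>, the factors \<open>v t\<close> stay in the right
    half-plane, so the principal logarithm is continuous along them.\<close>
  have Rev: "0 < Re (v t)" if "t \<in> {0..1}" for t
  proof -
    have "\<bar>Re (v t) - 1\<bar> \<le> norm (v t - 1)"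
      using abs_Re_le_cmod[of "v t - 1"] by simp
    then show ?thesis
      using small[OF that] \<delta>(2) norm_ge_zero[of "d t"] by linarith
  qed
  have v': "v t \<notin> \<real>\<^sub>\<le>\<^sub>0" "v t \<noteq> 0" if "t \<in> {0..1}" for t
    using Rev[OF that] by (auto simp: complex_nonpos_Reals_iff)
  define \<psi> where "\<psi> t = Ln (v t)" for t
  have \<psi>: "continuous_on {0..1} \<psi>" "\<psi> 0 = 0"
    using v' by (auto simp: \<psi>_def [abs_def] ends intro!: continuous_intros cont)
  have exp_\<psi>: "exp (\<psi> t) = v t" if "t \<in> {0..1}" for t
    using v'[OF that] by (simp add: \<psi>_def)
  define \<theta> where "\<theta> = Im (\<psi> 1)"
  have \<psi>1: "\<psi> 1 = \<i> * of_real \<theta>"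
    using nv[of 1] v'[of 1] by (simp add: \<theta>_def \<psi>_def complex_eq_iff)
  have v1e: "v 1 = exp (\<i> * of_real \<theta>)"
    using exp_\<psi>[of 1] \<psi>1 by simp
  have \<theta>: "\<theta> \<noteq> 0" "\<bar>\<theta>\<bar> \<le> pi"
  proof -
    show "\<theta> \<noteq> 0"
      using v1 v1e by (intro notI) simp
    show "\<bar>\<theta>\<bar> \<le> pi"
      using mpi_less_Im_Ln[of "v 1"] Im_Ln_le_pi[of "v 1"] v'(2)[of 1] by (simp add: \<theta>_def \<psi>_def)
  qed
  have v1le: "norm (v 1 - 1) \<le> \<bar>\<theta>\<bar>" "norm (v 1 - 1) \<le> \<delta>"
  proof -
    show "norm (v 1 - 1) \<le> \<bar>\<theta>\<bar>"
      using abs_sin_x_le_abs_x[of "\<theta> / 2"] by (simp add: v1e dist_exp_i_1)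
    have "norm (v 1 - 1) + norm (d 1) \<le> \<delta>"
      by (rule small) simp
    then show "norm (v 1 - 1) \<le> \<delta>"
      using norm_ge_zero[of "d 1"] by linarith
  qed
  have \<eta>0: "0 < \<eta>"
    using \<eta> \<delta> by (smt (verit) mult_nonneg_nonneg norm_ge_zero)
  \<comment> \<open>The most steps that do not exceed a full turn; at most one step's angle
    remains.\<close>
  define N where "N = nat \<lfloor>2 * pi / \<bar>\<theta>\<bar>\<rfloor>"
  have N: "real N * \<bar>\<theta>\<bar> \<le> 2 * pi" "2 * pi \<le> (real N + 1) * \<bar>\<theta>\<bar>"
  proof -
    have "0 \<le> \<lfloor>2 * pi / \<bar>\<theta>\<bar>\<rfloor>" by simp
    then have "real N \<le> 2 * pi / \<bar>\<theta>\<bar>" "2 * pi / \<bar>\<theta>\<bar> \<le> real N + 1"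
      by (auto simp: N_def)
    then show "real N * \<bar>\<theta>\<bar> \<le> 2 * pi" "2 * pi \<le> (real N + 1) * \<bar>\<theta>\<bar>"
      using \<theta> by (auto simp: field_simps)
  qed
  have "real N * \<epsilon> \<le> 2 * pi / norm (v 1 - 1) * \<epsilon>"
  proof (intro mult_right_mono)
    have "real N * norm (v 1 - 1) \<le> 2 * pi"
      using N(1) v1le(1) by (meson mult_left_mono of_nat_0_le_iff order_trans)
    then show "real N \<le> 2 * pi / norm (v 1 - 1)"
      using v1 by (simp add: field_simps)
  qed (use \<epsilon> in auto)
  then have "ennreal (real N * \<epsilon>) \<le> emeasure lborel (ball p (\<rho> / 2))"
    using area by (meson ennreal_leI order_trans)
  then obtain x0 where x0: "x0 \<in> ball p (\<rho> / 2)" "\<And>k. k < N \<Longrightarrow> ((\<lambda>x. v 1 * x + d 1) ^^ k) x0 \<notin> U"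
    using orbit_avoiding_open_set[OF nv[of 1] U, of N p "\<rho> / 2" "d 1"] p(1) \<epsilon> by auto
  have x0': "x0 \<in> ball p \<rho>" using x0(1) p(1) by auto
  have "0 < norm (x0 - z)"
    using p(3)[OF x0'] A(4) norm_ge_zero[of "k1 - z"] \<eta>0 by linarith
  then have x0z: "r1 + \<eta> \<le> norm (x0 - z)" "norm (x0 - z) \<le> r2 - \<eta>" "x0 \<noteq> z"
    using p(3)[OF x0'] by auto
  \<comment> \<open>Logarithmic coordinate of the \<open>k\<close>-th orbit point relative to
    \<open>z\<close>, with the angle not reduced modulo a full turn.\<close>
  define c where "c k = Ln (x0 - z) + of_nat k * (\<i> * of_real \<theta>)" for k
  have exp_c: "exp (c k) = (x0 - z) * v 1 ^ k" for k
    using x0z(3) by (simp add: c_def exp_add v1e exp_of_nat_mult)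
  have orbit: "((\<lambda>x. v 1 * x + d 1) ^^ k) x0 = z + exp (c k)" for k
  proof (induction k)
    case (Suc k)
    have "v 1 * (z + exp (c k)) + d 1 = (v 1 * z + d 1) + exp (c (Suc k))"
      by (simp add: exp_c algebra_simps)
    with Suc fixp show ?case by simp
  qed (use x0z in \<open>simp add: c_def\<close>)
  have norm_exp_c: "norm (exp (c k)) = norm (x0 - z)" for k
    using nv[of 1] by (simp add: exp_c norm_mult norm_power)
  define K where "K = (\<lambda>x. x - z) ` A"
  define G where "G = {\<zeta>. exp \<zeta> \<notin> K \<and> r1 < norm (exp \<zeta>) \<and> norm (exp \<zeta>) < r2}"
  have piece: "path_component G (c k) (c (Suc k))" if k: "k < N" for k
  proof -
    \<comment> \<open>The translation part of the motion in coordinates centred at \<open>z\<close>.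
      It vanishes at both ends because \<open>z\<close> is fixed by the complete step, and its bound
      by \<open>\<eta>\<close> keeps the curve in the annulus.\<close>
    define d' where "d' t = d t + (v t - 1) * z" for t
    have d': "norm (d' t) < \<eta>" if t: "t \<in> {0..1}" for t
    proof -
      have "norm (d' t) \<le> norm (d t) + norm (v t - 1) * norm z"
        unfolding d'_def by (metis norm_triangle_ineq norm_mult)
      also have "\<dots> \<le> \<delta> + \<delta> * norm z"
        using small[OF t] norm_ge_zero[of "d t"] norm_ge_zero[of "v t - 1"]
        by (intro add_mono mult_right_mono norm_ge_zero) linarith+
      finally show ?thesis using \<eta> by (simp add: ring_distribs)
    qed
    have nexp: "norm (exp (\<psi> t) * exp (c k)) = norm (x0 - z)" if "t \<in> {0..1}" for t
      using exp_\<psi>[OF that] nv[OF that] by (simp add: norm_mult norm_exp_c del: norm_exp_eq_Re)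
    have "path_component G (c k) (c k + \<psi> 1)"
    proof (rule path_component_log_motion[where d = d'])
      show "continuous_on {0..1} d'"
        unfolding d'_def [abs_def] by (intro continuous_intros cont)
      show "d' 0 = 0" "d' 1 = 0"
        using ends fixp by (auto simp: d'_def algebra_simps)
      show "norm (d' t) < norm (exp (\<psi> t) * exp (c k))" if "t \<in> {0..1}" for t
        using d'[OF that] nexp[OF that] x0z(1) A(4) norm_ge_zero[of "k1 - z"] by linarith
      show "\<zeta> \<in> G" if t: "t \<in> {0..1}" and \<zeta>: "exp \<zeta> = exp (\<psi> t) * exp (c k) + d' t" for t \<zeta>
      proof -
        have "exp \<zeta> = v t * (z + exp (c k)) + d t - z"
          by (simp add: \<zeta> d'_def exp_\<psi>[OF t] algebra_simps)
        moreover have "v t * (z + exp (c k)) + d t \<notin> A"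
          using avoid[OF x0(2)[OF k] t] by (simp add: orbit)
        ultimately have "exp \<zeta> \<notin> K"
          by (auto simp: K_def)
        moreover have "r1 < norm (exp \<zeta>)" "norm (exp \<zeta>) < r2"
          using norm_triangle_ineq[of "exp (\<psi> t) * exp (c k)" "d' t"]
            norm_diff_ineq[of "exp (\<psi> t) * exp (c k)" "d' t"] nexp[OF t] d'[OF t] x0z
          unfolding \<zeta> by linarith+
        ultimately show ?thesis by (simp add: G_def)
      qed
    qed (use \<psi> in auto)
    also have "c k + \<psi> 1 = c (Suc k)"
      by (simp add: c_def \<psi>1 algebra_simps)
    finally show ?thesis .
  qed
  have near: "\<zeta> \<in> G" if "z + exp \<zeta> \<in> ball p \<rho>" for \<zeta>
  proof -
    have "z + exp \<zeta> \<notin> A"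
      using that p(2) by auto
    then have "exp \<zeta> \<notin> K"
      by (auto simp: K_def)
    then show ?thesis
      using p(3)[OF that] \<eta>0 by (simp add: G_def)
  qed
  have "c 0 \<in> G"
    using x0' x0z(3) by (intro near) (simp add: c_def)
  then have chain: "path_component G (c 0) (c k)" if "k \<le> N" for k
    using that
  proof (induction k)
    case (Suc k)
    then show ?case
      using piece[of k] by (meson Suc_le_lessD Suc_leD path_component_trans)
  qed (simp add: path_component_refl)
  \<comment> \<open>The sense of rotation.\<close>
  define m :: int where "m = (if \<theta> > 0 then 1 else - 1)"
  have mabs: "of_int m * \<bar>\<theta>\<bar> = \<theta>"
    by (simp add: m_def)
  have mm: "\<bar>real_of_int m\<bar> = 1" by (simp add: m_def)
  \<comment> \<open>The image of this segment is the arc about \<open>z\<close> completing the turn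
    back to \<open>x0\<close>. Its angle \<open>s\<close> to \<open>x0\<close> is at most that of
    one step, so its points lie within \<open>r2 * \<delta> < \<rho> / 2\<close> of
    \<open>x0\<close>.\<close>
  have "closed_segment (c N) (c 0 + 2 * of_real pi * \<i> * of_int m) \<subseteq> G"
  proof
    fix \<zeta> assume "\<zeta> \<in> closed_segment (c N) (c 0 + 2 * of_real pi * \<i> * of_int m)"
    then obtain w where w: "0 \<le> w" "w \<le> 1"
      and \<zeta>: "\<zeta> = (1 - w) *\<^sub>R c N + w *\<^sub>R (c 0 + 2 * of_real pi * \<i> * of_int m)"
      by (auto simp: closed_segment_def)
    define s where "s = (1 - w) * (2 * pi - real N * \<bar>\<theta>\<bar>)"
    have s: "0 \<le> s" "s \<le> \<bar>\<theta>\<bar>"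
    proof -
      show "0 \<le> s" using w N by (simp add: s_def)
      have "s \<le> 1 * (2 * pi - real N * \<bar>\<theta>\<bar>)"
        unfolding s_def using w N by (intro mult_right_mono) auto
      also have "\<dots> \<le> \<bar>\<theta>\<bar>" using N by (simp add: algebra_simps)
      finally show "s \<le> \<bar>\<theta>\<bar>" .
    qed
    have t: "(of_int m :: complex) * of_real \<bar>\<theta>\<bar> = of_real \<theta>"
      using mabs by (metis of_real_mult of_real_of_int_eq)
    have "\<zeta> = c 0 + \<i> * of_real (- (of_int m * s)) + 2 * of_real pi * \<i> * of_int m"
      unfolding \<zeta> c_def s_def t[symmetric] scaleR_conv_of_real by (simp add: algebra_simps)
    moreover have "exp (2 * of_real pi * \<i> * of_int m) = 1"
      by (auto simp: exp_eq_1)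
    ultimately have "exp \<zeta> = exp (c 0) * exp (\<i> * of_real (- (of_int m * s)))"
      by (simp only: exp_add mult_1_right)
    then have e: "exp \<zeta> - (x0 - z) = (x0 - z) * (exp (\<i> * of_real (- (of_int m * s))) - 1)"
      by (simp add: exp_c algebra_simps)
    have "norm (exp \<zeta> - (x0 - z)) = norm (x0 - z) * norm (exp (\<i> * of_real (- (of_int m * s))) - 1)"
      unfolding e by (rule norm_mult)
    also have "\<dots> \<le> norm (x0 - z) * norm (v 1 - 1)"
      unfolding v1e using s \<theta> mm
      by (intro mult_left_mono norm_exp_i_minus_1_mono) (auto simp: abs_mult)
    also have "\<dots> \<le> r2 * \<delta>"
    proof (intro mult_mono)
      show "norm (x0 - z) \<le> r2" "0 \<le> r2"
        using x0z(2) \<eta>0 norm_ge_zero[of "x0 - z"] by linarith+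
    qed (use v1le(2) in auto)
    finally have "dist x0 (z + exp \<zeta>) < \<rho> / 2"
      using r2 by (simp add: dist_norm norm_minus_commute algebra_simps)
    then have "z + exp \<zeta> \<in> ball p \<rho>"
      using x0(1) dist_triangle[of p "z + exp \<zeta>" x0] by simp
    then show "\<zeta> \<in> G" by (rule near)
  qed
  then have "path_component G (c N) (c 0 + 2 * of_real pi * \<i> * of_int m)"
    by (rule path_component_linepath)
  with chain[of N] have "path_component G (c 0) (c 0 + 2 * of_real pi * \<i> * of_int m)"
    by (meson order_refl path_component_trans)
  moreover have "connected K"
    unfolding K_def by (intro connected_continuous_image continuous_intros A)
  moreover have "k1 - z \<in> K" "k2 - z \<in> K"
    using A by (auto simp: K_def)
  ultimately show False
    using A(4,5) exp_path_component_separates[of K r1 r2 "c 0" m "k1 - z" "k2 - z"]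
    by (auto simp: G_def m_def split: if_splits)
qed

text \<open>
  Here \<open>\<kappa>\<close> is chosen so that \<open>x \<mapsto> exp (\<kappa> * x)\<close> turns translation by \<open>b\<close> into rotation with period \<open>L\<close>;
  since \<open>L = 4 * R\<close>, it is injective on a strip that contains \<open>A\<close> in its middle half, and the curve
  starts and ends outside that middle half.
\<close>

lemma translation_case:
  fixes v d :: "real \<Rightarrow> complex" and A U :: "complex set"
  assumes motion: "small_motion A \<delta> \<epsilon> v d U"
    and \<delta>: "0 < \<delta>" and \<epsilon>: "0 < \<epsilon>"
    and drift: "norm (v 1 - 1) \<le> \<delta> * \<sigma>" "norm (d 1 - of_real \<delta> * b) \<le> \<delta> * \<sigma>"
    and R: "\<And>x. x \<in> A \<Longrightarrow> norm x \<le> R" "0 < R" and L: "L = 4 * R"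
    and b: "norm b = 1" and \<kappa>: "\<kappa> = 2 * of_real pi * \<i> / (of_real L * b)"
    and A: "connected A" "k1 \<in> A" "k2 \<in> A" "Re (\<kappa> * k1) \<le> m1" "m2 \<le> Re (\<kappa> * k2)"
    and \<tau>: "2 * \<tau> \<le> m2 - m1" "\<tau> \<le> pi / 2"
    and p: "\<kappa> * p = of_real ((m1 + m2) / 2) - \<i> * of_real pi" and \<rho>: "0 < \<rho>" "\<rho> \<le> 1"
    and err: "norm \<kappa> * (\<rho> + L * \<sigma> * (norm p + 2 + L) + \<delta> * (norm p + 2 + L)) < \<tau>"
    and area: "ennreal (L / \<delta> * \<epsilon>) \<le> emeasure lborel (ball p \<rho>)"
  shows False
proof -
  have cont: "continuous_on {0..1} v" "continuous_on {0..1} d" and nv: "\<And>t. t \<in> {0..1} \<Longrightarrow> norm (v t) = 1"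
    and ends: "v 0 = 1" "d 0 = 0" and small: "\<And>t. t \<in> {0..1} \<Longrightarrow> norm (v t - 1) + norm (d t) \<le> \<delta>"
    and U: "open U" "emeasure lborel U < ennreal \<epsilon>"
    and avoid: "\<And>x t. x \<notin> U \<Longrightarrow> t \<in> {0..1} \<Longrightarrow> v t * x + d t \<notin> A"
    using motion by (simp_all add: small_motion_def)
  have L0: "0 < L" using L R by simp
  have b0: "b \<noteq> 0" using b by auto
  have \<kappa>0: "\<kappa> \<noteq> 0" using L0 b0 by (simp add: \<kappa>)
  have n\<kappa>: "norm \<kappa> = 2 * pi / L"
    using L0 b by (simp add: \<kappa> norm_divide norm_mult)
  have \<kappa>b: "\<kappa> * b = \<i> * of_real (2 * pi / L)"
    using b0 L0 by (simp add: \<kappa> field_simps)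
  have \<sigma>0: "0 \<le> \<sigma>"
    using drift(1) \<delta> norm_ge_zero[of "v 1 - 1"] by (metis mult_less_0_iff not_le order_trans)
  \<comment> \<open>A step moves by about \<open>\<delta> * b\<close>, so \<open>N\<close> steps
    cover one period \<open>L\<close> up to a remainder of at most \<open>\<delta>\<close>.\<close>
  define N where "N = nat \<lfloor>L / \<delta>\<rfloor>"
  have N: "real N * \<delta> \<le> L" "L \<le> real N * \<delta> + \<delta>" "real N \<le> L / \<delta>"
  proof -
    have "0 \<le> \<lfloor>L / \<delta>\<rfloor>" using L0 \<delta> by simp
    then show "real N \<le> L / \<delta>" by (simp add: N_def)
    moreover have "L / \<delta> \<le> real N + 1"
      using \<open>0 \<le> \<lfloor>L / \<delta>\<rfloor>\<close> by (simp add: N_def)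
    ultimately show "real N * \<delta> \<le> L" "L \<le> real N * \<delta> + \<delta>"
      using \<delta> by (auto simp: field_simps)
  qed
  have "real N * \<epsilon> \<le> L / \<delta> * \<epsilon>"
    using N(3) \<epsilon> by (intro mult_right_mono) auto
  then have "ennreal (real N * \<epsilon>) \<le> emeasure lborel (ball p \<rho>)"
    using area by (meson ennreal_leI order_trans)
  then obtain x0 where x0: "x0 \<in> ball p \<rho>" "\<And>k. k < N \<Longrightarrow> ((\<lambda>x. v 1 * x + d 1) ^^ k) x0 \<notin> U"
    using orbit_avoiding_open_set[OF nv[of 1] U, of N p \<rho> "d 1"] \<rho>(1) \<epsilon> by auto
  define X where "X k = ((\<lambda>x. v 1 * x + d 1) ^^ k) x0" for k
  have X0: "X 0 = x0" and XS: "X (Suc k) = v 1 * X k + d 1" for k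
    by (simp_all add: X_def)
  have nx0: "norm x0 \<le> norm p + 1"
    using x0(1) \<rho>(2) norm_triangle_sub[of x0 p] by (simp add: dist_norm norm_minus_commute)
  have d1: "norm (d 1) \<le> \<delta>"
  proof -
    have "norm (v 1 - 1) + norm (d 1) \<le> \<delta>" by (rule small) simp
    then show ?thesis using norm_ge_zero[of "v 1 - 1"] by linarith
  qed
  have nX: "norm (X k) \<le> norm p + 1 + real k * \<delta>" for k
  proof (induction k)
    case (Suc k)
    have "norm (X (Suc k)) \<le> norm (X k) + \<delta>"
      using norm_triangle_ineq[of "v 1 * X k" "d 1"] nv[of 1] d1 by (simp add: XS norm_mult)
    with Suc show ?case by (simp add: algebra_simps)
  qed (use nx0 in \<open>simp add: X0\<close>)
  have nXL: "norm (X k) \<le> norm p + 1 + L" if "k \<le> N" for k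
  proof -
    have "real k * \<delta> \<le> real N * \<delta>" using that \<delta> by (intro mult_right_mono) auto
    then show ?thesis using nX[of k] N(1) by linarith
  qed
  \<comment> \<open>One more than the bound on \<open>norm (X k)\<close>: the extra 1 absorbs the
    translation part of the error of a step.\<close>
  define Q where "Q = norm p + 2 + L"
  have Q: "0 \<le> Q" using L0 by (simp add: Q_def add_nonneg_nonneg)
  \<comment> \<open>Each step errs by at most \<open>\<delta> * (\<sigma> * Q)\<close>. Over at most
    \<open>L / \<delta>\<close> steps this adds up to \<open>L * \<sigma> * Q\<close>, which is
    small with \<open>\<sigma>\<close> alone.\<close>
  have eX: "norm (X k - (x0 + of_real (real k * \<delta>) * b)) \<le> real k * \<delta> * (\<sigma> * Q)" if "k \<le> N" for k
    using that
  proof (induction k)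
    case (Suc k)
    have eq: "X (Suc k) - (x0 + of_real (real (Suc k) * \<delta>) * b)
        = (X k - (x0 + of_real (real k * \<delta>) * b)) + ((v 1 - 1) * X k + (d 1 - of_real \<delta> * b))"
      by (simp add: XS algebra_simps)
    have "norm ((v 1 - 1) * X k + (d 1 - of_real \<delta> * b)) \<le> norm (v 1 - 1) * norm (X k) + norm (d 1 - of_real \<delta> * b)"
      by (metis norm_triangle_ineq norm_mult)
    also have "\<dots> \<le> (\<delta> * \<sigma>) * (norm p + 1 + L) + \<delta> * \<sigma>"
      using drift nXL[of k] Suc.prems \<delta> \<sigma>0 by (intro add_mono mult_mono) auto
    also have "\<dots> = \<delta> * (\<sigma> * Q)" by (simp add: Q_def algebra_simps)
    finally have "norm ((v 1 - 1) * X k + (d 1 - of_real \<delta> * b)) \<le> \<delta> * (\<sigma> * Q)" .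
    with Suc have "norm (X (Suc k) - (x0 + of_real (real (Suc k) * \<delta>) * b)) \<le> real k * \<delta> * (\<sigma> * Q) + \<delta> * (\<sigma> * Q)"
      unfolding eq by (intro norm_triangle_mono) auto
    then show ?case by (simp add: algebra_simps)
  qed (simp add: X0)
  have eXL: "norm (X k - (p + of_real (real k * \<delta>) * b)) \<le> \<rho> + L * \<sigma> * Q" if "k \<le> N" for k
  proof -
    have "real k * \<delta> \<le> L"
      using that \<delta> N(1) by (meson mult_right_mono of_nat_le_iff order_less_imp_le order_trans)
    then have "real k * \<delta> * (\<sigma> * Q) \<le> L * (\<sigma> * Q)"
      using \<sigma>0 Q by (intro mult_right_mono mult_nonneg_nonneg)
    with eX[OF that] have "norm (X k - (x0 + of_real (real k * \<delta>) * b)) \<le> L * \<sigma> * Q"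
      by (simp add: mult.assoc)
    moreover have "norm (x0 - p) \<le> \<rho>"
      using x0(1) by (simp add: dist_norm norm_minus_commute)
    moreover have "X k - (p + of_real (real k * \<delta>) * b) = (x0 - p) + (X k - (x0 + of_real (real k * \<delta>) * b))"
      by simp
    ultimately show ?thesis
      by (metis norm_triangle_le add_mono)
  qed
  define K where "K = (\<lambda>x. exp (\<kappa> * x)) ` A"
  define G where "G = {\<zeta>. exp \<zeta> \<notin> K \<and> exp m1 < norm (exp \<zeta>) \<and> norm (exp \<zeta>) < exp m2}"
  have ImA: "\<bar>Im (\<kappa> * x)\<bar> \<le> pi / 2" if "x \<in> A" for x
  proof -
    have "\<bar>Im (\<kappa> * x)\<bar> \<le> 2 * pi / L * norm x"
      using abs_Im_le_cmod[of "\<kappa> * x"] by (simp add: norm_mult n\<kappa>)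
    also have "\<dots> \<le> 2 * pi / L * R"
      using R(1)[OF that] L0 by (intro mult_left_mono) auto
    also have "\<dots> = pi / 2" using R(2) by (simp add: L)
    finally show ?thesis .
  qed
  \<comment> \<open>Points with equal exponentials differ by a multiple of
    \<open>2 * pi * \<i>\<close>. Imaginary parts below \<open>3 * pi / 2\<close> and at most
    \<open>pi / 2\<close> in absolute value leave only the multiple zero.\<close>
  have GI: "\<kappa> * y \<in> G" if "y \<notin> A" "\<bar>Im (\<kappa> * y)\<bar> < 3 * pi / 2" "m1 < Re (\<kappa> * y)" "Re (\<kappa> * y) < m2" for y
  proof -
    have "exp (\<kappa> * y) \<notin> K"
    proof
      assume "exp (\<kappa> * y) \<in> K"
      then obtain x where x: "x \<in> A" "exp (\<kappa> * y) = exp (\<kappa> * x)"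
        by (auto simp: K_def)
      then obtain n :: int where n: "\<kappa> * y = \<kappa> * x + of_real (of_int (2 * n) * pi) * \<i>"
        unfolding exp_eq by blast
      then have "Im (\<kappa> * y) = Im (\<kappa> * x) + 2 * of_int n * pi"
        by (simp only: plus_complex.sel) simp
      then have "\<bar>2 * of_int n * pi\<bar> < 2 * pi"
        using ImA[OF x(1)] that(2) by linarith
      then have "\<bar>real_of_int n\<bar> < 1"
        by (simp add: abs_mult)
      then have "n = 0" by linarith
      with n \<kappa>0 have "y = x" by simp
      with x that(1) show False by simp
    qed
    with that show ?thesis by (simp add: G_def)
  qed
  \<comment> \<open>In logarithmic coordinates the ideal line \<open>p + s * b\<close> rises from
    imaginary part \<open>- pi\<close> at \<open>s = 0\<close> to \<open>pi\<close> at
    \<open>s = L\<close>, with real part midway between \<open>m1\<close> and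
    \<open>m2\<close>.\<close>
  have close: "\<bar>Im (\<kappa> * y) - (2 * pi / L * s - pi)\<bar> < \<tau>" "m1 < Re (\<kappa> * y)" "Re (\<kappa> * y) < m2"
    if "norm (y - (p + of_real s * b)) \<le> \<rho> + L * \<sigma> * Q + \<delta> * Q" for y s
  proof -
    define w where "w = \<kappa> * (y - (p + of_real s * b))"
    have "\<kappa> * y = \<kappa> * p + of_real s * (\<kappa> * b) + w"
      by (simp add: w_def algebra_simps)
    then have e: "\<kappa> * y = of_real ((m1 + m2) / 2) - \<i> * of_real pi + \<i> * of_real (2 * pi / L * s) + w"
      unfolding p \<kappa>b by (simp add: mult_ac)
    have "norm w \<le> norm \<kappa> * (\<rho> + L * \<sigma> * Q + \<delta> * Q)"
      unfolding w_def norm_mult using that by (intro mult_left_mono) auto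
    also have "\<dots> < \<tau>" using err by (simp add: Q_def)
    finally have lt: "\<bar>Re w\<bar> < \<tau>" "\<bar>Im w\<bar> < \<tau>"
      using abs_Re_le_cmod[of w] abs_Im_le_cmod[of w] by linarith+
    have Imy: "Im (\<kappa> * y) = - pi + 2 * pi / L * s + Im w"
      unfolding e by simp
    have Rey: "Re (\<kappa> * y) = (m1 + m2) / 2 + Re w"
      unfolding e by simp
    show "\<bar>Im (\<kappa> * y) - (2 * pi / L * s - pi)\<bar> < \<tau>"
      unfolding Imy using lt by linarith
    show "m1 < Re (\<kappa> * y)" "Re (\<kappa> * y) < m2"
      unfolding Rey using lt \<tau>(1) by (simp_all add: abs_less_iff field_simps)
  qed
  have range: "2 * pi / L * (real k * \<delta>) \<le> 2 * pi" "0 \<le> 2 * pi / L * (real k * \<delta>)" if "k \<le> N" for k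
  proof -
    have "real k * \<delta> \<le> L"
      using that \<delta> N(1) by (meson mult_right_mono of_nat_le_iff order_less_imp_le order_trans)
    then show "2 * pi / L * (real k * \<delta>) \<le> 2 * pi"
      using L0 by (simp add: field_simps)
    show "0 \<le> 2 * pi / L * (real k * \<delta>)"
      using L0 \<delta> by simp
  qed
  have piece: "path_component G (\<kappa> * X k) (\<kappa> * X (Suc k))" if k: "k < N" for k
  proof (rule path_on_unit_interval[of "\<lambda>t. \<kappa> * (v t * X k + d t)"])
    show "continuous_on {0..1} (\<lambda>t. \<kappa> * (v t * X k + d t))"
      by (intro continuous_intros cont)
    fix t :: real assume t: "t \<in> {0..1}"
    define y where "y = v t * X k + d t"
    have "y \<notin> A"
      using avoid[OF x0(2)[OF k] t] by (simp add: y_def X_def)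
    have "norm (y - X k) \<le> norm (v t - 1) * norm (X k) + norm (d t)"
    proof -
      have "y - X k = (v t - 1) * X k + d t" by (simp add: y_def algebra_simps)
      then show ?thesis by (metis norm_triangle_ineq norm_mult)
    qed
    also have "\<dots> \<le> \<delta> * (norm p + 1 + L) + \<delta>"
    proof (intro add_mono mult_mono)
      show "norm (v t - 1) \<le> \<delta>" "norm (d t) \<le> \<delta>"
        using small[OF t] norm_ge_zero[of "v t - 1"] norm_ge_zero[of "d t"] by linarith+
      show "norm (X k) \<le> norm p + 1 + L" using nXL k by simp
    qed (use \<delta> in auto)
    also have "\<dots> = \<delta> * Q" by (simp add: Q_def algebra_simps)
    finally have "norm (y - X k) \<le> \<delta> * Q" .
    then have "norm ((X k - (p + of_real (real k * \<delta>) * b)) + (y - X k)) \<le> \<rho> + L * \<sigma> * Q + \<delta> * Q"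
      using eXL[of k] k by (intro norm_triangle_mono) auto
    then have c: "norm (y - (p + of_real (real k * \<delta>) * b)) \<le> \<rho> + L * \<sigma> * Q + \<delta> * Q"
      by (simp add: algebra_simps)
    show "\<kappa> * (v t * X k + d t) \<in> G"
      unfolding y_def[symmetric]
    proof (rule GI)
      show "\<bar>Im (\<kappa> * y)\<bar> < 3 * pi / 2"
        using close(1)[OF c] range[OF less_imp_le[OF k]] \<tau>(2) by linarith
    qed (use \<open>y \<notin> A\<close> close[OF c] in auto)
  qed (simp_all add: ends XS)
  \<comment> \<open>Near either end the imaginary part is within \<open>\<tau> \<le> pi / 2\<close>
    of \<open>- pi\<close> or \<open>pi\<close>, beyond the range that \<open>A\<close> occupies.
    Hence no avoidance of \<open>U\<close> has to be invoked here.\<close>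
  have ends_free: "\<kappa> * y \<in> G"
    if c: "norm (y - (p + of_real s * b)) \<le> \<rho> + L * \<sigma> * Q + \<delta> * Q" and s: "s = 0 \<or> s = L" for y s
  proof (rule GI)
    have sv: "2 * pi / L * s - pi = - pi \<or> 2 * pi / L * s - pi = pi"
      using s L0 by auto
    then show "\<bar>Im (\<kappa> * y)\<bar> < 3 * pi / 2"
      using close(1)[OF c] \<tau>(2) by linarith
    show "y \<notin> A"
    proof
      assume "y \<in> A"
      from ImA[OF this] show False
        using close(1)[OF c] \<tau>(2) sv by linarith
    qed
  qed (use close[OF c] in auto)
  have "\<kappa> * X 0 \<in> G"
    using x0(1) Q \<delta> L0 \<sigma>0 by (intro ends_free[where s = 0]) (simp_all add: X0 dist_norm norm_minus_commute add_increasing2)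
  then have chain: "path_component G (\<kappa> * X 0) (\<kappa> * X k)" if "k \<le> N" for k
    using that
  proof (induction k)
    case (Suc k)
    then show ?case
      using piece[of k] by (meson Suc_le_lessD Suc_leD path_component_trans)
  qed (simp add: path_component_refl)
  \<comment> \<open>The curve is closed by a segment from the last orbit point to the start shifted
    by one period. Both lie in a disc about \<open>p + L * b\<close> that is free of
    \<open>A\<close>, and discs are convex.\<close>
  have "closed_segment (\<kappa> * X N) (\<kappa> * (X 0 + of_real L * b)) \<subseteq> G"
  proof
    fix \<zeta> assume "\<zeta> \<in> closed_segment (\<kappa> * X N) (\<kappa> * (X 0 + of_real L * b))"
    also have "closed_segment (\<kappa> * X N) (\<kappa> * (X 0 + of_real L * b)) = (*) \<kappa> ` closed_segment (X N) (X 0 + of_real L * b)"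
      by (rule closed_segment_linear_image) (simp add: linear_times)
    finally obtain y where y: "y \<in> closed_segment (X N) (X 0 + of_real L * b)" "\<zeta> = \<kappa> * y"
      by blast
    let ?r = "\<rho> + L * \<sigma> * Q + \<delta> * Q"
    have "\<delta> \<le> \<delta> * Q" using \<delta> L0 by (simp add: Q_def add_nonneg_nonneg)
    have "X N \<in> cball (p + of_real L * b) ?r"
    proof -
      have "norm (of_real (real N * \<delta>) * b - of_real L * b) = \<bar>real N * \<delta> - L\<bar>"
        by (metis b left_diff_distrib mult.right_neutral norm_mult norm_of_real of_real_diff)
      also have "\<dots> \<le> \<delta> * Q" using N \<open>\<delta> \<le> \<delta> * Q\<close> by linarith
      finally have "norm ((X N - (p + of_real (real N * \<delta>) * b)) + (of_real (real N * \<delta>) * b - of_real L * b)) \<le> ?r"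
        using eXL[of N] by (intro norm_triangle_mono) auto
      then show ?thesis by (simp add: dist_norm norm_minus_commute algebra_simps)
    qed
    moreover have "X 0 + of_real L * b \<in> cball (p + of_real L * b) ?r"
      using x0(1) Q \<delta> L0 \<sigma>0 by (simp add: X0 dist_norm norm_minus_commute add_increasing2)
    ultimately have "y \<in> cball (p + of_real L * b) ?r"
      using y(1) closed_segment_subset[OF _ _ convex_cball] by blast
    then show "\<zeta> \<in> G"
      unfolding y(2) by (intro ends_free[where s = L]) (simp_all add: dist_norm norm_minus_commute)
  qed
  then have "path_component G (\<kappa> * X N) (\<kappa> * (X 0 + of_real L * b))"
    by (rule path_component_linepath)
  with chain[of N] have "path_component G (\<kappa> * X 0) (\<kappa> * (X 0 + of_real L * b))"
    by (meson order_refl path_component_trans)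
  also have "\<kappa> * (X 0 + of_real L * b) = \<kappa> * X 0 + 2 * of_real pi * \<i> * of_int 1"
    using L0 b0 by (simp add: \<kappa> field_simps)
  finally have "path_component G (\<kappa> * X 0) (\<kappa> * X 0 + 2 * of_real pi * \<i> * of_int 1)" .
  moreover have "connected K"
    unfolding K_def by (intro connected_continuous_image continuous_intros A)
  moreover have "exp (\<kappa> * k1) \<in> K" "exp (\<kappa> * k2) \<in> K"
    using A by (auto simp: K_def)
  ultimately show False
    using A(4,5) exp_path_component_separates[of K "exp m1" "exp m2" "\<kappa> * X 0" 1 "exp (\<kappa> * k1)" "exp (\<kappa> * k2)"]
    by (auto simp: G_def)
qed

section \<open>Passing to the limit\<close>

text \<open>The rescaled steps \<open>x \<mapsto> a n * x + b n\<close> are normalised by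
  \<open>norm (a n) + norm (b n) = 1\<close>, so a subsequence has a nonzero limit. If
  \<open>a'\<close> is nonzero, the limit is an infinitesimal rotation about
  \<open>- b' / a'\<close>; otherwise it is a translation along \<open>b'\<close>.\<close>

lemma strong_kakeya_subset_line_or_circle:
  assumes sk: "strong_kakeya A" and A: "closed A" "connected A" "A \<noteq> {}"
  shows "(\<exists>z r. A \<subseteq> sphere z r) \<or> (\<exists>\<kappa> s. \<kappa> \<noteq> 0 \<and> (\<forall>x\<in>A. Re (\<kappa> * x) = s))"
proof -
  define \<delta> where "\<delta> n = 1 / (real n + 2)" for n :: nat
  have \<delta>: "0 < \<delta> n" "\<delta> n < 1" for n
    by (auto simp: \<delta>_def)
  have \<delta>0: "\<delta> \<longlonglongrightarrow> 0"
    unfolding \<delta>_def [abs_def] by real_asymp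
  \<comment> \<open>An orbit takes on the order of \<open>1 / \<delta> n\<close> steps, so the area
    must be small compared with \<open>\<delta> n\<close>; the square is.\<close>
  have "\<exists>v d U. small_motion A (\<delta> n) ((\<delta> n)\<^sup>2) v d U" for n
    using strong_kakeya_small_motion[OF sk zero_less_power[OF \<delta>(1)] \<delta>(1) less_imp_le[OF \<delta>(2)], of n n 2]
    by blast
  then obtain v d U where m: "small_motion A (\<delta> n) ((\<delta> n)\<^sup>2) (v n) (d n) (U n)" for n
    by metis
  define a where "a n = (v n 1 - 1) / of_real (\<delta> n)" for n
  define b where "b n = d n 1 / of_real (\<delta> n)" for n
  have va: "v n 1 = 1 + of_real (\<delta> n) * a n" and db: "d n 1 = of_real (\<delta> n) * b n" for n
    using \<delta>(1)[of n] by (auto simp: a_def b_def)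
  have ab1: "norm (a n) + norm (b n) = 1" for n
  proof -
    have "\<delta> n * (norm (a n) + norm (b n)) = \<delta> n * 1"
      using m[of n] \<delta>(1)[of n] by (simp add: small_motion_def va db norm_mult distrib_left)
    then show ?thesis using \<delta>(1)[of n] by simp
  qed
  have "(a n, b n) \<in> cball 0 1 \<times> cball 0 1" for n
  proof -
    have "norm (a n) \<le> 1" "norm (b n) \<le> 1"
      using ab1[of n] norm_ge_zero[of "a n"] norm_ge_zero[of "b n"] by linarith+
    then show ?thesis by simp
  qed
  moreover have "seq_compact (cball 0 1 \<times> cball 0 1 :: (complex \<times> complex) set)"
    by (intro compact_imp_seq_compact compact_Times compact_cball)
  ultimately obtain l \<phi> where \<phi>: "strict_mono (\<phi> :: nat \<Rightarrow> nat)" and l: "((\<lambda>n. (a n, b n)) \<circ> \<phi>) \<longlonglongrightarrow> l"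
    using seq_compactE[of "cball 0 1 \<times> cball 0 1" "\<lambda>n. (a n, b n)"] by blast
  obtain a' b' where l': "l = (a', b')" by fastforce
  have la: "(\<lambda>n. a (\<phi> n)) \<longlonglongrightarrow> a'" and lb: "(\<lambda>n. b (\<phi> n)) \<longlonglongrightarrow> b'"
    using tendsto_fst[OF l] tendsto_snd[OF l] by (simp_all add: o_def l')
  have l\<delta>: "(\<lambda>n. \<delta> (\<phi> n)) \<longlonglongrightarrow> 0"
    using LIMSEQ_subseq_LIMSEQ[OF \<delta>0 \<phi>] by (simp add: o_def)
  have ab': "norm a' + norm b' = 1"
  proof (rule LIMSEQ_unique)
    show "(\<lambda>n. norm (a (\<phi> n)) + norm (b (\<phi> n))) \<longlonglongrightarrow> norm a' + norm b'"
      by (intro tendsto_intros la lb)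
  qed (simp add: ab1)
  show ?thesis
  proof (cases "a' = 0")
    case False
    define z where "z = - b' / a'"
    \<comment> \<open>The fixed points of the actual steps, which converge to the centre
      \<open>z\<close>.\<close>
    define Z where "Z n = - b (\<phi> n) / a (\<phi> n)" for n
    have lZ: "Z \<longlonglongrightarrow> z"
      unfolding Z_def [abs_def] z_def by (intro tendsto_intros la lb False)
    have "norm (k2 - z) \<le> norm (k1 - z)" if k: "k1 \<in> A" "k2 \<in> A" for k1 k2
    proof (rule ccontr)
      assume gt: "\<not> ?thesis"
      \<comment> \<open>The annulus \<open>T\<close> keeps distance \<open>3 * g\<close> from both
        radii. Two of these \<open>g\<close> absorb the change of centre from \<open>z\<close> to
        \<open>Z n\<close>, for \<open>k1\<close>, \<open>k2\<close> and for the ball; the third is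
        the margin \<open>\<eta>\<close>.\<close>
      define g where "g = (norm (k2 - z) - norm (k1 - z)) / 8"
      have g: "0 < g" using gt by (simp add: g_def)
      have kg: "norm (k2 - z) = norm (k1 - z) + 8 * g" by (simp add: g_def field_simps)
      define T where "T = {x. norm (k1 - z) + 3 * g < norm (x - z) \<and> norm (x - z) < norm (k1 - z) + 5 * g}"
      have "open T"
        unfolding T_def by (intro open_Collect_conj open_Collect_less continuous_intros)
      have "z + of_real (norm (k1 - z) + 4 * g) \<in> T"
      proof -
        have "norm (of_real (norm (k1 - z) + 4 * g) :: complex) = norm (k1 - z) + 4 * g"
          using g by (subst norm_of_real) simp
        then show ?thesis using g by (simp add: T_def)
      qed
      \<comment> \<open>Since \<open>A\<close> has empty interior, the open annulus contains a ball
        free of \<open>A\<close>, where the loop can start and close.\<close>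
      then have "\<not> T \<subseteq> A"
        using interior_maximal[OF _ \<open>open T\<close>, of A] strong_kakeya_interior_empty[OF sk] by blast
      then obtain p where "p \<in> T - A" by blast
      moreover have "open (T - A)"
        using \<open>open T\<close> A(1) by (rule open_Diff)
      ultimately obtain \<rho> where p: "0 < \<rho>" "ball p \<rho> \<subseteq> T - A"
        by (meson open_contains_ball)
      obtain \<epsilon>0 where \<epsilon>0: "0 < \<epsilon>0" "ennreal \<epsilon>0 \<le> emeasure lborel (ball p (\<rho> / 2))"
        using ennreal_pos_obtain_real[OF emeasure_ball_pos[of "\<rho> / 2" p]] p by auto
      have "eventually (\<lambda>n. dist (Z n) z < g) sequentially"
        using lZ g by (rule tendstoD)
      moreover have "eventually (\<lambda>n. a (\<phi> n) \<noteq> 0) sequentially"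
        using la False by (rule tendsto_imp_eventually_ne)
      moreover have "eventually (\<lambda>n. \<delta> (\<phi> n) * (1 + norm (Z n)) < g) sequentially"
      proof (rule order_tendstoD(2))
        show "(\<lambda>n. \<delta> (\<phi> n) * (1 + norm (Z n))) \<longlonglongrightarrow> 0 * (1 + norm z)"
          by (intro tendsto_intros l\<delta> lZ)
      qed (use g in simp)
      moreover have "eventually (\<lambda>n. (norm (k2 - z) - g) * \<delta> (\<phi> n) < \<rho> / 2) sequentially"
      proof (rule order_tendstoD(2))
        show "(\<lambda>n. (norm (k2 - z) - g) * \<delta> (\<phi> n)) \<longlonglongrightarrow> (norm (k2 - z) - g) * 0"
          by (intro tendsto_intros l\<delta>)
      qed (use p in simp)
      moreover have "eventually (\<lambda>n. 2 * pi / norm (a (\<phi> n)) * \<delta> (\<phi> n) < \<epsilon>0) sequentially"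
      proof (rule order_tendstoD(2))
        show "(\<lambda>n. 2 * pi / norm (a (\<phi> n)) * \<delta> (\<phi> n)) \<longlonglongrightarrow> 2 * pi / norm a' * 0"
          by (intro tendsto_intros l\<delta> la) (use False in auto)
      qed (use \<epsilon>0 in simp)
      ultimately have "eventually (\<lambda>n. False) sequentially"
      proof eventually_elim
        case (elim n)
        let ?n = "\<phi> n"
        have zZ: "norm (x - z) - g \<le> norm (x - Z n)" "norm (x - Z n) \<le> norm (x - z) + g" for x
          using elim(1) norm_triangle_ineq[of "x - z" "z - Z n"] norm_triangle_ineq[of "x - Z n" "Z n - z"]
          by (auto simp: dist_norm norm_minus_commute)
        show False
        proof (rule rotation_case[of A "\<delta> ?n" "(\<delta> ?n)\<^sup>2" "v ?n" "d ?n" "U ?n" "Z n" k1 k2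
              "norm (k1 - z) + g" "norm (k2 - z) - g" \<rho> p g])
          show "v ?n 1 * Z n + d ?n 1 = Z n" "v ?n 1 \<noteq> 1"
            using elim(2) \<delta>(1)[of ?n] by (auto simp: va db Z_def field_simps)
          show "norm (k1 - z) + g + g \<le> norm (x - Z n) \<and> norm (x - Z n) \<le> norm (k2 - z) - g - g"
            if "x \<in> ball p \<rho>" for x
          proof -
            have "x \<in> T" using p that by auto
            then show ?thesis using zZ[of x] kg by (auto simp: T_def)
          qed
          have "2 * pi / norm (v ?n 1 - 1) * (\<delta> ?n)\<^sup>2 = 2 * pi / norm (a ?n) * \<delta> ?n"
            using \<delta>(1)[of ?n] by (simp add: va norm_mult power2_eq_square)
          then show "ennreal (2 * pi / norm (v ?n 1 - 1) * (\<delta> ?n)\<^sup>2) \<le> emeasure lborel (ball p (\<rho> / 2))"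
            using elim(5) \<epsilon>0(2) by (metis ennreal_leI less_imp_le order_trans)
          show "ball p \<rho> \<inter> A = {}" using p by auto
        qed (use m[of ?n] \<delta>[of ?n] A k elim zZ[of k1] zZ[of k2] p in auto)
      qed
      then show False by simp
    qed
    then obtain r where "\<forall>x\<in>A. norm (x - z) = r"
      using A(3) by (metis order_antisym)
    then have "A \<subseteq> sphere z r"
      by (auto simp: dist_norm norm_minus_commute)
    then show ?thesis by blast
  next
    case True
    then have b': "norm b' = 1" using ab' by simp
    obtain R where R: "0 < R" "\<And>x. x \<in> A \<Longrightarrow> norm x \<le> R"
      using strong_kakeya_connected_imp_bounded[OF sk A(2)] unfolding bounded_pos by blast
    define L where "L = 4 * R"
    define \<kappa> where "\<kappa> = 2 * of_real pi * \<i> / (of_real L * b')"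
    have "b' \<noteq> 0" using b' by auto
    then have \<kappa>0: "\<kappa> \<noteq> 0" using R by (simp add: \<kappa>_def L_def)
    have "Re (\<kappa> * k2) \<le> Re (\<kappa> * k1)" if k: "k1 \<in> A" "k2 \<in> A" for k1 k2
    proof (rule ccontr)
      assume lt: "\<not> ?thesis"
      define m1 where "m1 = Re (\<kappa> * k1)"
      define m2 where "m2 = Re (\<kappa> * k2)"
      define \<tau> where "\<tau> = min ((m2 - m1) / 2) (pi / 2)"
      have \<tau>: "0 < \<tau>" "2 * \<tau> \<le> m2 - m1" "\<tau> \<le> pi / 2"
        using lt by (auto simp: \<tau>_def m1_def m2_def min_def)
      \<comment> \<open>In logarithmic coordinates \<open>p\<close> lies midway between
        \<open>m1\<close> and \<open>m2\<close>, half a period below the real axis.\<close>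
      define p where "p = (of_real ((m1 + m2) / 2) - \<i> * of_real pi) / \<kappa>"
      \<comment> \<open>In the limit only the error \<open>norm \<kappa> * \<rho>\<close> survives;
        this radius keeps it below \<open>\<tau>\<close>.\<close>
      define \<rho> where "\<rho> = min 1 (\<tau> / (2 * norm \<kappa>))"
      have \<rho>: "0 < \<rho>" "\<rho> \<le> 1"
        using \<tau> \<kappa>0 by (auto simp: \<rho>_def)
      have "norm \<kappa> * \<rho> \<le> norm \<kappa> * (\<tau> / (2 * norm \<kappa>))"
        by (intro mult_left_mono) (auto simp: \<rho>_def)
      also have "\<dots> < \<tau>" using \<tau> \<kappa>0 by simp
      finally have \<kappa>\<rho>: "norm \<kappa> * \<rho> < \<tau>" .
      obtain \<epsilon>0 where \<epsilon>0: "0 < \<epsilon>0" "ennreal \<epsilon>0 \<le> emeasure lborel (ball p \<rho>)"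
        using ennreal_pos_obtain_real[OF emeasure_ball_pos[OF \<rho>(1), of p]] .
      \<comment> \<open>The deviation of the rescaled step from translation by \<open>b'\<close>; it
        tends to 0 because \<open>a' = 0\<close>.\<close>
      define \<sigma> where "\<sigma> n = norm (a (\<phi> n)) + norm (b (\<phi> n) - b')" for n
      have l\<sigma>: "\<sigma> \<longlonglongrightarrow> 0"
      proof -
        have "\<sigma> \<longlonglongrightarrow> norm a' + norm (b' - b')"
          unfolding \<sigma>_def [abs_def] by (intro tendsto_intros la lb)
        then show ?thesis by (simp add: True)
      qed
      have "eventually (\<lambda>n. norm \<kappa> * (\<rho> + L * \<sigma> n * (norm p + 2 + L) + \<delta> (\<phi> n) * (norm p + 2 + L)) < \<tau>) sequentially"
      proof (rule order_tendstoD(2))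
        show "(\<lambda>n. norm \<kappa> * (\<rho> + L * \<sigma> n * (norm p + 2 + L) + \<delta> (\<phi> n) * (norm p + 2 + L)))
          \<longlonglongrightarrow> norm \<kappa> * (\<rho> + L * 0 * (norm p + 2 + L) + 0 * (norm p + 2 + L))"
          by (intro tendsto_intros l\<delta> l\<sigma>)
      qed (use \<kappa>\<rho> in simp)
      moreover have "eventually (\<lambda>n. L * \<delta> (\<phi> n) < \<epsilon>0) sequentially"
      proof (rule order_tendstoD(2))
        show "(\<lambda>n. L * \<delta> (\<phi> n)) \<longlonglongrightarrow> L * 0"
          by (intro tendsto_intros l\<delta>)
      qed (use \<epsilon>0 in simp)
      ultimately have "eventually (\<lambda>n. False) sequentially"
      proof eventually_elim
        case (elim n)
        let ?n = "\<phi> n"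
        show False
        proof (rule translation_case[of A "\<delta> ?n" "(\<delta> ?n)\<^sup>2" "v ?n" "d ?n" "U ?n" "\<sigma> n" b' R L \<kappa> k1 k2 m1 m2 \<tau> p \<rho>])
          show "norm (v ?n 1 - 1) \<le> \<delta> ?n * \<sigma> n"
            using \<delta>(1)[of ?n] by (simp add: va norm_mult \<sigma>_def)
          have "d ?n 1 - of_real (\<delta> ?n) * b' = of_real (\<delta> ?n) * (b ?n - b')"
            by (simp add: db algebra_simps)
          then show "norm (d ?n 1 - of_real (\<delta> ?n) * b') \<le> \<delta> ?n * \<sigma> n"
            using \<delta>(1)[of ?n] by (simp add: norm_mult \<sigma>_def)
          have "L / \<delta> ?n * (\<delta> ?n)\<^sup>2 = L * \<delta> ?n"
            using \<delta>(1)[of ?n] by (simp add: power2_eq_square)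
          then show "ennreal (L / \<delta> ?n * (\<delta> ?n)\<^sup>2) \<le> emeasure lborel (ball p \<rho>)"
            using elim(2) \<epsilon>0(2) by (metis ennreal_leI less_imp_le order_trans)
          show "\<kappa> * p = of_real ((m1 + m2) / 2) - \<i> * of_real pi"
            using \<kappa>0 by (simp add: p_def)
        qed (use m[of ?n] \<delta>[of ?n] A k elim R b' \<tau> \<rho> in \<open>auto simp: L_def \<kappa>_def m1_def m2_def\<close>)
      qed
      then show False by simp
    qed
    then have "\<exists>s. \<forall>x\<in>A. Re (\<kappa> * x) = s"
      using A(3) by (metis order_antisym)
    with \<kappa>0 show ?thesis by blast
  qed
qed

section \<open>Connected subsets of lines and circles\<close>

lemma connected_compact_real_Icc:
  fixes S :: "real set"
  assumes "connected S" "compact S" "S \<noteq> {}"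
  obtains l u where "l \<le> u" "S = {l..u}"
  using assms connected_compact_interval_1[of S] by auto

text \<open>The coordinate \<open>g\<close> along the line maps \<open>A\<close> onto a compact
  interval, and the affine map \<open>f\<close> undoes it on \<open>A\<close>.\<close>

lemma compact_connected_in_line:
  assumes A: "compact A" "connected A" "A \<noteq> {}"
    and line: "\<kappa> \<noteq> 0" "\<And>x. x \<in> A \<Longrightarrow> Re (\<kappa> * x) = s"
  shows "is_line_segment A \<or> is_singleton A"
proof -
  obtain a0 where a0: "a0 \<in> A" using A by blast
  define g where "g x = Im (\<kappa> * (x - a0))" for x
  define f where "f t = a0 + of_real t * (\<i> / \<kappa>)" for t
  have fg: "f (g x) = x" if "x \<in> A" for x
  proof -
    have "\<kappa> * (x - a0) = \<i> * of_real (g x)"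
      using line(2)[OF that] line(2)[OF a0] by (simp add: complex_eq_iff g_def algebra_simps)
    then have "x - a0 = \<i> * of_real (g x) / \<kappa>"
      using line(1) by (metis nonzero_mult_div_cancel_left)
    then show ?thesis by (simp add: f_def algebra_simps)
  qed
  have cg: "continuous_on A g"
    unfolding g_def [abs_def] by (intro continuous_intros)
  obtain l u where lu: "l \<le> u" "g ` A = {l..u}"
    using connected_compact_real_Icc[of "g ` A"] A cg
    by (metis compact_continuous_image connected_continuous_image image_is_empty)
  have "A = f ` g ` A"
    using fg by (force simp: image_image)
  then have Af: "A = f ` {l..u}" by (simp add: lu)
  have "f ` {l..u} = closed_segment (f l) (f u)"
  proof -
    have "{l..u} = closed_segment l u"
      using lu by (simp add: closed_segment_eq_real_ivl)
    moreover have "f ` closed_segment l u = (+) a0 ` ((\<lambda>t. of_real t * (\<i> / \<kappa>)) ` closed_segment l u)"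
      by (auto simp: f_def image_image)
    moreover have "(\<lambda>t. of_real t * (\<i> / \<kappa>)) ` closed_segment l u = closed_segment (of_real l * (\<i> / \<kappa>)) (of_real u * (\<i> / \<kappa>))"
      by (rule closed_segment_linear_image[symmetric, of "\<lambda>t. of_real t * (\<i> / \<kappa>)"])
         (auto intro!: linearI simp: algebra_simps scaleR_conv_of_real add_divide_distrib)
    ultimately show ?thesis
      by (simp add: f_def closed_segment_translation)
  qed
  with Af have AS: "A = closed_segment (f l) (f u)" by simp
  show ?thesis
  proof (cases "f l = f u")
    case True
    then have "A = {f l}" using AS by simp
    then show ?thesis by (simp add: is_singleton_def)
  qed (use AS in \<open>auto simp: is_line_segment_def\<close>)
qed

text \<open>A point \<open>q\<close> of the circle outside \<open>A\<close> serves as branch cut: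
  angles measured from its antipode are continuous on \<open>A\<close>, and they fill a compact
  interval inside the open interval from \<open>- pi\<close> to \<open>pi\<close>.\<close>

lemma compact_connected_in_circle:
  assumes A: "compact A" "connected A" "A \<noteq> {}" and sub: "A \<subset> sphere z r" and r: "0 < r"
  shows "is_circular_arc A \<or> is_singleton A"
proof -
  obtain q where "q \<in> sphere z r" "q \<notin> A"
    using sub by blast
  then have q: "norm (q - z) = r" "q \<notin> A"
    by (auto simp: dist_norm norm_minus_commute)
  have qz: "q - z \<noteq> 0" using q r by auto
  define w where "w x = (x - z) / (z - q)" for x
  define g where "g x = Im (Ln (w x))" for x
  have w: "norm (w x) = 1" "w x \<noteq> - 1" if "x \<in> A" for x
  proof -
    have "norm (x - z) = r" using sub that by (auto simp: dist_norm norm_minus_commute)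
    then show "norm (w x) = 1" using q r by (simp add: w_def norm_divide norm_minus_commute)
    show "w x \<noteq> - 1"
    proof
      assume "w x = - 1"
      then have "x = q" using qz by (simp add: w_def field_simps)
      with q that show False by simp
    qed
  qed
  have wn: "w x \<notin> \<real>\<^sub>\<le>\<^sub>0" if "x \<in> A" for x
  proof
    assume "w x \<in> \<real>\<^sub>\<le>\<^sub>0"
    then obtain t where "w x = of_real t" "t \<le> 0" by (auto elim: nonpos_Reals_cases)
    with w[OF that] show False by simp
  qed
  have wexp: "w x = cis (g x)" if "x \<in> A" for x
  proof -
    have "w x \<noteq> 0" using w[OF that] by auto
    then have "Re (Ln (w x)) = 0" using w[OF that] by simp
    then have "Ln (w x) = \<i> * of_real (g x)" by (simp add: complex_eq_iff g_def)
    then show ?thesis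
      using \<open>w x \<noteq> 0\<close> by (metis cis_conv_exp exp_Ln)
  qed
  have grange: "- pi < g x" "g x < pi" if "x \<in> A" for x
  proof -
    have "w x \<noteq> 0" using w[OF that] by auto
    then show "- pi < g x" using mpi_less_Im_Ln[of "w x"] by (simp add: g_def)
    have "g x \<noteq> pi"
      using wexp[OF that] w(2)[OF that] by auto
    then show "g x < pi" using Im_Ln_le_pi[OF \<open>w x \<noteq> 0\<close>] by (simp add: g_def)
  qed
  have "continuous_on A w"
    unfolding w_def [abs_def] using qz by (intro continuous_intros) auto
  then have cg: "continuous_on A g"
    unfolding g_def [abs_def] using wn by (intro continuous_intros) auto
  obtain l u where lu: "l \<le> u" "g ` A = {l..u}"
    using connected_compact_real_Icc[of "g ` A"] A cg
    by (metis compact_continuous_image connected_continuous_image image_is_empty)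
  define \<beta> where "\<beta> = Arg (z - q)"
  have "z - q = of_real (norm (z - q)) * cis (Arg (z - q))"
    using Arg_eq[of "z - q"] qz by (simp add: cis_conv_exp)
  then have \<beta>: "z - q = of_real r * cis \<beta>"
    using q by (simp add: \<beta>_def norm_minus_commute)
  define f where "f \<theta> = z + of_real r * cis \<theta>" for \<theta>
  have fg: "f (\<beta> + g x) = x" if "x \<in> A" for x
  proof -
    have "x - z = (z - q) * w x" using qz by (simp add: w_def)
    also have "\<dots> = of_real r * cis (\<beta> + g x)"
      by (simp add: \<beta> wexp[OF that] cis_mult[symmetric])
    finally show ?thesis by (simp add: f_def algebra_simps)
  qed
  have "A = f ` ((+) \<beta> ` (g ` A))"
    using fg by (force simp: image_image)
  then have Af: "A = f ` {\<beta> + l..\<beta> + u}"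
    by (simp add: lu add.commute)
  have "l \<in> g ` A" "u \<in> g ` A" using lu by auto
  then have "u < l + 2 * pi"
    using grange by (smt (verit) imageE)
  show ?thesis
  proof (cases "l = u")
    case True
    then have "A = {f (\<beta> + l)}" using Af by simp
    then show ?thesis by (simp add: is_singleton_def)
  next
    case False
    then have "is_circular_arc A"
      unfolding is_circular_arc_def
      using r lu \<open>u < l + 2 * pi\<close> Af
      by (intro exI[of _ z] exI[of _ r] exI[of _ "\<beta> + l"] exI[of _ "\<beta> + u"]) (auto simp: f_def [abs_def])
    then show ?thesis ..
  qed
qed

section \<open>Assembly of the classification\<close>

theorem theorem1p2:
  fixes A :: "complex set"
  assumes "A \<noteq> {}" and "closed A" and "connected A" and "strong_kakeya A"
  shows "is_line_segment A \<or> is_circular_arc A \<or> is_singleton A"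
proof -
  have "compact A"
    using strong_kakeya_connected_imp_bounded[OF assms(4,3)] assms(2) by (simp add: compact_eq_bounded_closed)
  consider z r where "A \<subseteq> sphere z r" | \<kappa> s where "\<kappa> \<noteq> 0" "\<And>x. x \<in> A \<Longrightarrow> Re (\<kappa> * x) = s"
    using strong_kakeya_subset_line_or_circle[OF assms(4,2,3,1)] by blast
  then show ?thesis
  proof cases
    case (1 z r)
    show ?thesis
    proof (cases "0 < r")
      case True
      then have "A \<subset> sphere z r"
        using 1 not_strong_kakeya_sphere[of z r] assms(4) by blast
      then show ?thesis
        using compact_connected_in_circle[OF \<open>compact A\<close> assms(3,1) _ True] by blast
    next
      \<comment> \<open>For \<open>r \<le> 0\<close> the sphere is empty or the single point
        \<open>z\<close>.\<close>
      case False
      then have "sphere z r \<subseteq> {z}"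
        using zero_le_dist[of z] by force
      then have "A = {z}" using 1 assms(1) by blast
      then show ?thesis by (simp add: is_singleton_def)
    qed
  next
    case 2
    then show ?thesis
      using compact_connected_in_line[OF \<open>compact A\<close> assms(3,1)] by blast
  qed
qed

end
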